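(* Let $\mathbb F$ be a division ring with center $Z_{\mathbb F}$, let $\Lambda=\{\alpha_1,\ldots,\alpha_n\}$ and $\Omega=\{\beta_1,\ldots,\beta_k\}$ be sets of distinct elements of $\mathbb F$, and assume every $\alpha_i$ is algebraic over $Z_{\mathbb F}$. The problem of finding $f$ with $$f^{\mathfrak e_\ell}(\alpha_i)=c_i\ (i=1,\ldots,n),\qquad f^{\mathfrak e_r}(\beta_j)=d_j\ (j=1,\ldots,k)\qquad( * )$$ has a solution $f\in P_{n+k}(\mathbb F)$ for any choice of $c_i,d_j\in\mathbb F$ if and only if the pair $(\Lambda,\Omega)$ is $P$-independent. In this case, a unique $f\in P_{n+k}(\mathbb F)$ satisfying $( * )$ is given by $$f(z)=\sum_{i=1}^n P_{\Lambda\setminus\{\alpha_i\},\ell}(z)\cdot\rho_i\cdot P_{\Omega,r}(z)+\sum_{j=1}^k P_{\Lambda,\ell}(z)\cdot\gamma_j\cdot P_{\Omega\setminus\{\beta_j\},r}(z),$$ where $$\rho_i=\sum_{j=1}^k P_{\Lambda\setminus\{\alpha_i\},\ell}^{\mathfrak e_\ell}(\alpha_i)^{-1}\,\Psi_{\alpha_i,\beta_j}(c_i)\,P_{\Omega\setminus\{\beta_j\},r}^{\mathfrak e_r}(\beta_j)^{-1},$$ $$\gamma_j=-\sum_{i=1}^n P_{\Lambda\setminus\{\alpha_i\},\ell}^{\mathfrak e_\ell}(\alpha_i)^{-1}\,\Psi_{\alpha_i,\beta_j}(d_j)\,P_{\Omega\setminus\{\beta_j\},r}^{\mathfrak e_r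}(\beta_j)^{-1}.$$
   Context: $\mathbb F[z]$ is the ring of polynomials in a variable $z$ commuting with the coefficients from $\mathbb F$; $P_N(\mathbb F)=\{g\in\mathbb F[z]:\deg g<N\}$ (including $0$). $[\alpha]=\{h\alpha h^{-1}:h\in\mathbb F\setminus\{0\}\}$. Evaluations: for $f(z)=\sum_{j=0}^m z^jf_j$, $f^{\mathfrak e_\ell}(\alpha)=\sum_j\alpha^jf_j$ and $f^{\mathfrak e_r}(\alpha)=\sum_j f_j\alpha^j$. If all coefficients are in $Z_{\mathbb F}$ the two values agree and are written $f(\alpha)$. $L_\alpha f$ is the unique polynomial with $f(z)=f^{\mathfrak e_\ell}(\alpha)+(z-\alpha)\cdot(L_\alpha f)(z)$. For a finite $\Delta\subset\mathbb F$, $P_{\Delta,\ell}$ is the monic generator of the right ideal $\{f: f^{\mathfrak e_\ell}|_\Delta=0\}$, and $P_{\Delta,r}$ is the monic generator of the left ideal $\{f: f^{\mathfrak e_r}|_\Delta=0\}$ ($P_{\varnothing,\ell}=P_{\varnothing,r}=1$). The pair $(\Lambda,\Omega)$ is $P$-independent if there is no nonzero $g\in P_{|\Lambda|+|\Omega|}(\mathbb F)$ with $g^{\mathfrak e_\ell}|_\Lambda=0$ and $g^{\mathfrak e_r}|_\Omega=0$. For $\alpha$ algebraic over $Z_{\mathbb F}$, $\mathcal X_{[\alpha]}\in Z_{\mathbb F}[z]$ is the (monic) minimal polynomial of $\alpha$ over $Z_{\mathbb F}$; its zero set in $\mathbb F$ is $[\alpha]$. For $\beta\notin[\alpha]$ and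 $\gamma\in\mathbb F$, $$\Psi_{\alpha,\beta}(\gamma)=-\big((L_\alpha\mathcal X_{[\alpha]})\gamma\big)^{\mathfrak e_r}(\beta)\cdot\mathcal X_{[\alpha]}(\beta)^{-1}.$$ (When $(\Lambda,\Omega)$ is $P$-independent and $\Lambda$ is algebraic over $Z_{\mathbb F}$, no $\alpha_i$ is conjugate to any $\beta_j$, so all these elements are defined.) *)

theory Defs
  imports "HOL-Library.Poly_Mapping"
begin

text \<open>
  The polynomial type of \<open>HOL-Computational_Algebra.Polynomial\<close> is a ring only over commutative
  coefficients. For a division ring \<open>'a\<close>, the polynomials in a variable that commutes with the
  coefficients are the finitely supported maps \<open>nat \<Rightarrow>\<^sub>0 'a\<close> with their convolution product:
  \<open>lookup f j\<close> is the coefficient of the \<open>j\<close>-th power of the variable.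
\<close>

definition Const :: "'a::division_ring \<Rightarrow> (nat \<Rightarrow>\<^sub>0 'a)"
  where "Const a = Poly_Mapping.single 0 a"

definition Z :: "nat \<Rightarrow>\<^sub>0 'a::division_ring"
  where "Z = Poly_Mapping.single 1 1"

text \<open>
  \<open>Poly_Mapping.degree f\<close> is one more than the usual degree of \<open>f \<noteq> 0\<close>, and it is \<open>0\<close> for \<open>f = 0\<close>.
\<close>

definition polys_below :: "nat \<Rightarrow> (nat \<Rightarrow>\<^sub>0 'a::division_ring) set"
  where "polys_below N = {g. Poly_Mapping.degree g \<le> N}"

definition monic :: "(nat \<Rightarrow>\<^sub>0 'a::division_ring) \<Rightarrow> bool"
  where "monic p \<longleftrightarrow> Poly_Mapping.lookup p (Poly_Mapping.degree p - 1) = 1"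

definition eval_l :: "(nat \<Rightarrow>\<^sub>0 'a::division_ring) \<Rightarrow> 'a \<Rightarrow> 'a"
  where "eval_l f a = (\<Sum>j\<in>Poly_Mapping.keys f. a ^ j * Poly_Mapping.lookup f j)"

definition eval_r :: "(nat \<Rightarrow>\<^sub>0 'a::division_ring) \<Rightarrow> 'a \<Rightarrow> 'a"
  where "eval_r f a = (\<Sum>j\<in>Poly_Mapping.keys f. Poly_Mapping.lookup f j * a ^ j)"

definition L_quot :: "'a::division_ring \<Rightarrow> (nat \<Rightarrow>\<^sub>0 'a) \<Rightarrow> (nat \<Rightarrow>\<^sub>0 'a)"
  where "L_quot a f = (THE g. f = Const (eval_l f a) + (Z - Const a) * g)"

definition P_l :: "'a::division_ring set \<Rightarrow> (nat \<Rightarrow>\<^sub>0 'a)"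
  where "P_l D = (THE p. monic p \<and> {f. \<forall>a\<in>D. eval_l f a = 0} = {p * h |h. True})"

definition P_r :: "'a::division_ring set \<Rightarrow> (nat \<Rightarrow>\<^sub>0 'a)"
  where "P_r D = (THE p. monic p \<and> {f. \<forall>a\<in>D. eval_r f a = 0} = {h * p |h. True})"

definition P_independent :: "'a::division_ring set \<Rightarrow> 'a set \<Rightarrow> bool"
  where "P_independent \<Lambda> \<Omega> \<longleftrightarrow>
    \<not> (\<exists>g \<in> polys_below (card \<Lambda> + card \<Omega>). g \<noteq> 0 \<and>
         (\<forall>a\<in>\<Lambda>. eval_l g a = 0) \<and> (\<forall>b\<in>\<Omega>. eval_r g b = 0))"

definition ring_center :: "'a::division_ring set"
  where "ring_center = {c. \<forall>x. c * x = x * c}"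

definition central_poly :: "(nat \<Rightarrow>\<^sub>0 'a::division_ring) \<Rightarrow> bool"
  where "central_poly p \<longleftrightarrow> (\<forall>j. Poly_Mapping.lookup p j \<in> ring_center)"

text \<open>For polynomials with central coefficients \<open>eval_l\<close> and \<open>eval_r\<close> coincide.\<close>

definition algebraic_over_center :: "'a::division_ring \<Rightarrow> bool"
  where "algebraic_over_center a \<longleftrightarrow> (\<exists>p. p \<noteq> 0 \<and> central_poly p \<and> eval_l p a = 0)"

definition min_poly :: "'a::division_ring \<Rightarrow> (nat \<Rightarrow>\<^sub>0 'a)"
  where "min_poly a = (THE p. monic p \<and> central_poly p \<and> eval_l p a = 0 \<and>
    (\<forall>q. q \<noteq> 0 \<and> central_poly q \<and> eval_l q a = 0 \<longrightarrow>
         Poly_Mapping.degree p \<le> Poly_Mapping.degree q))"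

text \<open>
  Meaningful for \<open>a\<close> algebraic over the center and \<open>b\<close> not conjugate to \<open>a\<close>; then
  \<open>eval_l (min_poly a) b \<noteq> 0\<close>.
\<close>

definition Psi :: "'a::division_ring \<Rightarrow> 'a \<Rightarrow> 'a \<Rightarrow> 'a"
  where "Psi a b c =
    - (eval_r (L_quot a (min_poly a) * Const c) b * inverse (eval_l (min_poly a) b))"

end

theory Submission
  imports Defs
begin

text \<open>
  Constants are mostly written without \<open>Const\<close> in the comments. Evaluation at \<open>a\<close> is not multiplicative,
  but one part of multiplicativity survives: the left value of \<open>f * g\<close> at \<open>a\<close> depends on \<open>f\<close> only
  through its own left value \<open>u\<close> at \<open>a\<close>, because
  \<open>f - u\<close> has \<open>Z - a\<close> as a left factor (\<open>eval_l_mult\<close>). If \<open>u \<noteq> 0\<close>, it equals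
  \<open>u\<close> times the value of \<open>g\<close> at the conjugate \<open>inverse u * a * u\<close>. Hence \<open>P_l\<close> can be built point by
  point (\<open>P_l_insert\<close>): each new point either is a zero already or contributes one linear factor with
  a conjugate root. Call a finite set left independent if every point contributes a factor; on such
  sets Lagrange interpolation works as in the commutative case. The same holds on the right, by
  passing to the opposite division ring.

  The two sides are coupled through the operator \<open>x \<mapsto> a * x - x * b\<close>, since for every \<open>f\<close> the
  left value at \<open>a\<close> minus the right value at \<open>b\<close> lies in its image (\<open>eval_l_minus_eval_r\<close>).
  Let \<open>a\<close> be algebraic over the center, with minimal polynomial \<open>X = (Z - a) * L\<close>. If \<open>X\<close> does not
  vanish at \<open>b\<close>, then \<open>Psi a b\<close> is a right inverse of this operator (\<open>Psi_sylvester\<close>). If \<open>X\<close> vanishes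
  at \<open>b\<close>, the operator is neither injective, so that \<open>a\<close> and \<open>b\<close> are conjugate
  (\<open>min_poly_root_iff_conjugate\<close>), nor surjective (\<open>sylvester_not_surjective\<close>); both
  come from the fact that \<open>y \<mapsto> eval_r (L * y) b\<close> is then a nonzero map
  (\<open>L_quot_min_poly_nonvanishing\<close>).

  A pair \<open>(\<Lambda>, \<Omega>)\<close> is \<open>P\<close>-independent exactly if \<open>\<Lambda>\<close> is left independent, \<open>\<Omega>\<close> is right
  independent and no point of \<open>\<Lambda>\<close> is conjugate to a point of \<open>\<Omega>\<close> (\<open>P_independentI\<close>,
  \<open>P_independentD\<close>). Solvability for all data forces each of these three conditions, the third one by
  the failure of surjectivity. For the converse, let both sets be nonempty; otherwise one-sided Lagrange
  interpolation is enough. In the formula of the theorem, at \<open>a \<in> \<Lambda>\<close> all summands vanish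
  except the one containing \<open>P_l (\<Lambda> - {a})\<close>. There the factors \<open>Psi a b (c a)\<close>
  turn \<open>Z - b\<close> into \<open>Z - a\<close> up to the constant \<open>c a\<close>, and what remains is \<open>c a\<close> times
  the sum of the right Lagrange polynomials of \<open>\<Omega>\<close>, which is \<open>1\<close> (\<open>eval_l_sandwich\<close>). The points of \<open>\<Omega>\<close>
  are handled symmetrically (\<open>eval_r_sandwich\<close>). Uniqueness is the definition of
  \<open>P\<close>-independence applied to a difference.
\<close>

section \<open>Coefficients and degrees\<close>

abbreviation coeff :: "(nat \<Rightarrow>\<^sub>0 'a::zero) \<Rightarrow> nat \<Rightarrow> 'a"
  where "coeff \<equiv> Poly_Mapping.lookup"

abbreviation deg :: "(nat \<Rightarrow>\<^sub>0 'a::zero) \<Rightarrow> nat"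
  where "deg \<equiv> Poly_Mapping.degree"

lemma deg_le_iff: "deg f \<le> n \<longleftrightarrow> (\<forall>j\<ge>n. coeff f j = 0)"
proof
  assume "deg f \<le> n" then show "\<forall>j\<ge>n. coeff f j = 0"
    by (meson beyond_degree_lookup_zero order_trans)
next
  assume r: "\<forall>j\<ge>n. coeff f j = 0"
  show "deg f \<le> n"
  proof (rule ccontr)
    assume "\<not> deg f \<le> n"
    then have "deg f - 1 \<in> Poly_Mapping.keys f" "n \<le> deg f - 1"
      using degree_greater_zero_in_keys[of f] by auto
    then show False using r by (auto simp: in_keys_iff)
  qed
qed

lemma deg_pos: "f \<noteq> 0 \<Longrightarrow> 0 < deg f"
  by (metis degree_zero_iff gr0I)

lemma lead_coeff_nonzero: "f \<noteq> 0 \<Longrightarrow> coeff f (deg f - 1) \<noteq> 0"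
  using degree_greater_zero_in_keys[OF deg_pos] by (auto simp: in_keys_iff)

lemma deg_eqI: "deg f \<le> Suc n \<Longrightarrow> coeff f n \<noteq> 0 \<Longrightarrow> deg f = Suc n"
  by (metis beyond_degree_lookup_zero le_antisym not_less_eq_eq)

lemma deg_add_le: "deg f \<le> n \<Longrightarrow> deg g \<le> n \<Longrightarrow> deg (f + g) \<le> n"
  by (auto simp: deg_le_iff lookup_add)

lemma deg_diff_le: "deg f \<le> n \<Longrightarrow> deg g \<le> n \<Longrightarrow> deg (f - g) \<le> n"
  by (auto simp: deg_le_iff lookup_minus)

lemma deg_sum_le: "(\<And>i. i \<in> I \<Longrightarrow> deg (f i) \<le> n) \<Longrightarrow> deg (\<Sum>i\<in>I. f i) \<le> n"
  by (simp add: deg_le_iff lookup_sum)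

text \<open>
  Every polynomial is a sum of monomials, so an additive property need only be checked on these.
\<close>

lemma poly_induct [case_names zero add_single]:
  assumes "P 0" and "\<And>f j c. P f \<Longrightarrow> P (f + Poly_Mapping.single j c)"
  shows "P (f :: nat \<Rightarrow>\<^sub>0 'a::monoid_add)"
proof (induction f rule: update_induct)
  case const show ?case by (rule assms(1))
next
  case (update f j c)
  have "Poly_Mapping.update j c f = f + Poly_Mapping.single j c"
    using update(1) by (intro poly_mapping_eqI) (auto simp: lookup_update lookup_add lookup_single when_def in_keys_iff)
  then show ?case using assms(2) update by simp
qed

lemma coeff_single_mult:
  "coeff (Poly_Mapping.single i c * (g :: nat \<Rightarrow>\<^sub>0 'a::ring_1)) j = (if i \<le> j then c * coeff g (j - i) else 0)"
  by (induction g rule: poly_induct)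
    (auto simp: distrib_left lookup_add mult_single lookup_single when_def)

lemma coeff_mult:
  fixes f g :: "nat \<Rightarrow>\<^sub>0 'a::ring_1"
  shows "coeff (f * g) n = (\<Sum>i\<le>n. coeff f i * coeff g (n - i))"
proof (induction f rule: poly_induct)
  case zero show ?case by simp
next
  case (add_single f j c)
  have "(\<Sum>i\<le>n. coeff (Poly_Mapping.single j c) i * coeff g (n - i)) =
      (\<Sum>i\<le>n. if i = j then c * coeff g (n - j) else 0)"
    by (intro sum.cong) (auto simp: lookup_single when_def)
  also have "\<dots> = coeff (Poly_Mapping.single j c * g) n"
    by (auto simp: coeff_single_mult)
  finally show ?case
    using add_single by (simp add: distrib_right lookup_add sum.distrib)
qed

lemma coeff_mult_top:
  fixes f g :: "nat \<Rightarrow>\<^sub>0 'a::ring_1"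
  assumes "deg f \<le> Suc m" "deg g \<le> Suc n"
  shows "coeff (f * g) (m + n) = coeff f m * coeff g n"
proof -
  have "coeff f i * coeff g (m + n - i) = (if i = m then coeff f m * coeff g n else 0)" for i
  proof -
    consider "i = m" | "Suc m \<le> i" | "Suc n \<le> m + n - i" by linarith
    then show ?thesis using assms by cases (auto simp: deg_le_iff)
  qed
  then show ?thesis by (simp add: coeff_mult)
qed

lemma deg_mult_le:
  fixes f g :: "nat \<Rightarrow>\<^sub>0 'a::ring_1"
  assumes "deg f \<le> Suc m" "deg g \<le> n"
  shows "deg (f * g) \<le> m + n"
  unfolding deg_le_iff coeff_mult
proof (intro allI impI sum.neutral ballI)
  fix j i assume "m + n \<le> j"
  then have "Suc m \<le> i \<or> n \<le> j - i" by linarith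
  then show "coeff f i * coeff g (j - i) = 0" using assms by (auto simp: deg_le_iff)
qed

text \<open>
  The shift by one in \<open>deg\<close> accounts for the \<open>Suc\<close>: the usual degrees are \<open>deg f - 1\<close> and \<open>deg g - 1\<close>,
  and they add up because a division ring has no zero divisors.
\<close>

lemma deg_mult:
  fixes f g :: "nat \<Rightarrow>\<^sub>0 'a::division_ring"
  assumes "f \<noteq> 0" "g \<noteq> 0"
  shows "Suc (deg (f * g)) = deg f + deg g"
proof -
  obtain m n where mn: "deg f = Suc m" "deg g = Suc n"
    using assms by (metis degree_zero_iff not0_implies_Suc)
  then have "coeff (f * g) (m + n) = coeff f m * coeff g n"
    by (intro coeff_mult_top) auto
  also have "\<dots> \<noteq> 0"
    using lead_coeff_nonzero[OF assms(1)] lead_coeff_nonzero[OF assms(2)] mn by simp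
  finally show ?thesis
    using deg_eqI[of "f * g" "m + n"] deg_mult_le[of f m g "Suc n"] mn by simp
qed

section \<open>Constants, linear and monic polynomials\<close>

lemma coeff_Const: "coeff (Const c) j = (if j = 0 then c else 0)"
  by (simp add: Const_def lookup_single when_def)

lemma Const_0 [simp]: "Const 0 = 0" and Const_1 [simp]: "Const 1 = 1"
  by (simp_all add: Const_def)

lemma Const_mult: "Const (a * b) = Const a * Const b"
  by (simp add: Const_def mult_single)

lemma Const_add: "Const (a + b) = Const a + Const b"
  and Const_diff: "Const (a - b) = Const a - Const b"
  by (simp_all add: Const_def single_add single_diff)

lemma Const_sum: "Const (\<Sum>i\<in>I. c i) = (\<Sum>i\<in>I. Const (c i))"
  by (induction I rule: infinite_finite_induct) (simp_all add: Const_add)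

lemma Const_eq_0_iff [simp]: "Const a = 0 \<longleftrightarrow> a = 0"
  by (metis Const_0 Const_def lookup_single_eq)

lemma coeff_Const_mult: "coeff (Const c * f) j = c * coeff f j"
  by (simp add: Const_def coeff_single_mult)

lemma coeff_mult_Const: "coeff (f * Const c) j = coeff f j * c"
proof -
  have "coeff f i * coeff (Const c) (j - i) = (if i = j then coeff f j * c else 0)" if "i \<le> j" for i
    using that by (auto simp: coeff_Const)
  then show ?thesis by (simp add: coeff_mult)
qed

lemma deg_mult_Const_le: "deg (f * Const c) \<le> deg f"
  by (simp add: deg_le_iff coeff_mult_Const beyond_degree_lookup_zero)

lemma deg_Const_mult: "c \<noteq> 0 \<Longrightarrow> deg (Const c * f) = deg f"
  by (rule antisym) (simp_all add: deg_le_iff coeff_Const_mult beyond_degree_lookup_zero)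

lemma Z_power: "Z ^ n = Poly_Mapping.single n 1"
  by (induction n) (simp_all add: Z_def mult_single)

lemma single_eq_Const_mult: "Poly_Mapping.single n c = Const c * Z ^ n"
  and single_eq_mult_Const: "Poly_Mapping.single n c = Z ^ n * Const c"
  by (simp_all add: Z_power Const_def mult_single)

lemma Z_commute: "Z * f = f * Z"
  by (induction f rule: poly_induct) (simp_all add: distrib_left distrib_right Z_def mult_single)

lemma coeff_linear: "coeff (Z - Const a) j = (if j = 0 then - a else if j = 1 then 1 else 0)"
  by (simp add: lookup_minus coeff_Const Z_def lookup_single when_def)

lemma linear_nonzero: "Z - Const a \<noteq> 0"
  by (metis coeff_linear lookup_zero one_neq_zero)

lemma deg_linear: "deg (Z - Const a) = 2"
  using deg_eqI[of "Z - Const a" 1] by (simp add: deg_le_iff coeff_linear numeral_2_eq_2)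

text \<open>
  Moving a constant past a linear factor replaces the root by a conjugate.
\<close>

lemma linear_mult_Const:
  "a * x = x * b \<Longrightarrow> (Z - Const a) * Const x = Const x * (Z - Const b)"
  by (simp add: algebra_simps Z_commute flip: Const_mult)

lemma monic_nonzero: "monic p \<Longrightarrow> p \<noteq> 0"
  by (auto simp: monic_def)

lemma monic_mult:
  assumes "monic p" "monic q" shows "monic (p * q)"
proof -
  obtain m n where mn: "deg p = Suc m" "deg q = Suc n"
    using assms monic_nonzero by (metis degree_zero_iff not0_implies_Suc)
  have "Suc (deg (p * q)) = deg p + deg q"
    using assms by (intro deg_mult monic_nonzero)
  then have "deg (p * q) - 1 = m + n" using mn by simp
  then show ?thesis
    using coeff_mult_top[of p m q n] mn assms by (simp add: monic_def)
qed

lemma monic_linear: "monic (Z - Const a)"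
  by (simp add: monic_def deg_linear coeff_linear)

lemma monic_1: "monic 1"
  by (simp add: monic_def)

lemma deg_monic_diff_less:
  assumes "monic p" "monic q" "deg p = deg q"
  shows "deg (p - q) < deg p"
proof -
  obtain m where m: "deg p = Suc m"
    using assms monic_nonzero by (metis degree_zero_iff not0_implies_Suc)
  have "coeff (p - q) j = 0" if "j \<ge> m" for j
    using that assms(1,2) m assms(3)[symmetric]
    by (cases "j = m") (auto simp: lookup_minus monic_def beyond_degree_lookup_zero)
  then show ?thesis using m by (simp add: deg_le_iff less_Suc_eq_le)
qed

section \<open>Left evaluation\<close>

lemma eval_l_altdef: "deg f \<le> n \<Longrightarrow> eval_l f a = (\<Sum>j<n. a ^ j * coeff f j)"
  unfolding eval_l_def
  by (rule sum.mono_neutral_left) (use in_keys_less_degree[of _ f] in \<open>auto simp: in_keys_iff intro: less_le_trans\<close>)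

lemma eval_l_0 [simp]: "eval_l 0 a = 0"
  by (simp add: eval_l_def)

lemma eval_l_add: "eval_l (f + g) a = eval_l f a + eval_l g a"
proof -
  define n where "n = max (deg f) (deg g)"
  have "deg f \<le> n" "deg g \<le> n" "deg (f + g) \<le> n"
    using deg_add_le[of f n g] by (auto simp: n_def)
  then show ?thesis
    by (simp add: eval_l_altdef lookup_add algebra_simps sum.distrib)
qed

lemma eval_l_uminus: "eval_l (- f) a = - eval_l f a"
  using eval_l_add[of f "- f" a] by (simp add: add_eq_0_iff)

lemma eval_l_diff: "eval_l (f - g) a = eval_l f a - eval_l g a"
  using eval_l_add[of f "- g" a] by (simp add: eval_l_uminus)

lemma eval_l_sum: "eval_l (\<Sum>i\<in>I. f i) a = (\<Sum>i\<in>I. eval_l (f i) a)"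
  by (induction I rule: infinite_finite_induct) (simp_all add: eval_l_add)

lemma eval_l_single [simp]: "eval_l (Poly_Mapping.single j c) a = a ^ j * c"
  by (cases "c = 0") (simp_all add: eval_l_def)

lemma eval_l_Const [simp]: "eval_l (Const c) a = c"
  by (simp add: Const_def)

lemma eval_l_1 [simp]: "eval_l 1 a = 1"
  by (metis Const_1 eval_l_Const)

lemma eval_l_Z_mult: "eval_l (Z * f) a = a * eval_l f a"
  by (induction f rule: poly_induct)
    (simp_all add: distrib_left eval_l_add Z_def mult_single mult.assoc)

lemma eval_l_mult_Const: "eval_l (f * Const c) a = eval_l f a * c"
  by (induction f rule: poly_induct)
    (simp_all add: distrib_right eval_l_add Const_def mult_single mult.assoc)

lemma eval_l_Const_mult_central:
  "a * c = c * a \<Longrightarrow> eval_l (Const c * f) a = c * eval_l f a"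
  by (induction f rule: poly_induct)
    (simp_all add: distrib_left eval_l_add Const_def mult_single mult.assoc[symmetric] power_commuting_commutes)

lemma eval_l_linear_mult: "eval_l ((Z - Const a) * f) a = 0"
  by (simp add: left_diff_distrib eval_l_diff eval_l_Z_mult eval_l_Const_mult_central)

text \<open>
  Reduction to powers of \<open>Z\<close>, where \<open>Z ^ Suc j = Z * a ^ j + (Z - a) * g * Z\<close> and
  \<open>Z * a ^ j = a ^ Suc j + (Z - a) * a ^ j\<close>.
\<close>

lemma left_linear_division: "\<exists>g. f = Const (eval_l f a) + (Z - Const a) * g"
proof (induction f rule: poly_induct)
  case zero show ?case by (rule exI[of _ 0]) simp
next
  case (add_single f j c)
  have "\<exists>g. Z ^ j = Const (a ^ j) + (Z - Const a) * g"
  proof (induction j)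
    case 0 show ?case by (rule exI[of _ 0]) simp
  next
    case (Suc j)
    then obtain g where "Z ^ j = Const (a ^ j) + (Z - Const a) * g" by blast
    then have "Z ^ Suc j = Z * Const (a ^ j) + (Z - Const a) * g * Z"
      by (simp only: power_Suc Z_commute distrib_right mult.assoc)
    also have "\<dots> = Const (a ^ Suc j) + (Z - Const a) * (Const (a ^ j) + g * Z)"
      by (simp add: algebra_simps Const_mult)
    finally show ?case by blast
  qed
  then obtain g where g: "Z ^ j = Const (a ^ j) + (Z - Const a) * g" by blast
  have s: "Poly_Mapping.single j c = Const (a ^ j * c) + (Z - Const a) * (g * Const c)"
    unfolding single_eq_mult_Const g by (simp add: distrib_right mult.assoc Const_mult)
  from add_single obtain h where h: "f = Const (eval_l f a) + (Z - Const a) * h" by blast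
  have "f + Poly_Mapping.single j c = Const (eval_l (f + Poly_Mapping.single j c) a) + (Z - Const a) * (h + g * Const c)"
    by (subst h, subst s) (simp add: eval_l_add Const_add algebra_simps)
  then show ?case by blast
qed

lemma eval_l_eq_0_iff: "eval_l f a = 0 \<longleftrightarrow> (\<exists>g. f = (Z - Const a) * g)"
  using left_linear_division[of f a] eval_l_linear_mult by auto

lemma L_quot_eq: "f = Const (eval_l f a) + (Z - Const a) * L_quot a f"
proof -
  have "\<exists>!g. f = Const (eval_l f a) + (Z - Const a) * g"
    using left_linear_division[of f a] linear_nonzero[of a]
    by (metis add_left_cancel mult_left_cancel)
  then show ?thesis unfolding L_quot_def by (rule theI')
qed

text \<open>
  Writing \<open>f = Const (eval_l f a) + (Z - Const a) * q\<close>, the second summand stays a multiple of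
  \<open>Z - Const a\<close> after multiplication by \<open>g\<close> on the right.
\<close>

lemma eval_l_mult: "eval_l (f * g) a = eval_l (Const (eval_l f a) * g) a"
  by (subst L_quot_eq[of f a]) (simp add: distrib_right eval_l_add mult.assoc eval_l_linear_mult)

lemma eval_l_mult_eq_0: "eval_l f a = 0 \<Longrightarrow> eval_l (f * g) a = 0"
  by (subst eval_l_mult) simp

text \<open>
  The relation \<open>a * x = x * b\<close> passes to powers, so \<open>x\<close> can be pulled out to the left of every term
  \<open>a ^ j * x\<close>.
\<close>

lemma eval_l_mult_conj:
  assumes "a * x = x * b" shows "eval_l (Const x * g) a = x * eval_l g b"
proof (induction g rule: poly_induct)
  case (add_single f j c)
  have "a ^ j * x = x * b ^ j"
    by (induction j) (use assms in \<open>simp_all add: mult.assoc, simp add: mult.assoc[symmetric]\<close>)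
  then have "eval_l (Const x * Poly_Mapping.single j c) a = x * (b ^ j * c)"
    by (simp add: Const_def mult_single mult.assoc[symmetric])
  then show ?case using add_single by (simp add: distrib_left eval_l_add)
qed simp

section \<open>The opposite division ring and right evaluation\<close>

text \<open>
  Reversing the multiplication of \<open>'a\<close> exchanges left and right evaluation, and left and right
  multiples. Statements about \<open>eval_r\<close> and \<open>P_r\<close> are obtained from those about \<open>eval_l\<close> and \<open>P_l\<close> over
  \<open>'a opp\<close>, along the anti-isomorphism \<open>opp_poly\<close> of polynomial rings.
\<close>

typedef 'a opp = "UNIV :: 'a set" morphisms of_opp to_opp ..

lemma of_opp_to_opp [simp]: "of_opp (to_opp x) = x"
  by (simp add: to_opp_inverse)

lemma to_opp_of_opp [simp]: "to_opp (of_opp x) = x"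
  by (rule of_opp_inverse)

lemma opp_eq_iff: "x = y \<longleftrightarrow> of_opp x = of_opp y"
  by (simp add: of_opp_inject)

instantiation opp :: (division_ring) division_ring
begin

definition "0 = to_opp 0"
definition "1 = to_opp 1"
definition "x + y = to_opp (of_opp x + of_opp y)"
definition "x - y = to_opp (of_opp x - of_opp y)"
definition "- x = to_opp (- of_opp x)"
definition "x * y = to_opp (of_opp y * of_opp x)"
definition "inverse x = to_opp (inverse (of_opp x))"
definition "divide x y = x * inverse y" for x y :: "'a opp"

lemmas opp_defs = zero_opp_def one_opp_def plus_opp_def minus_opp_def uminus_opp_def
  times_opp_def inverse_opp_def

instance
  by standard (simp_all add: opp_defs divide_opp_def opp_eq_iff algebra_simps)

end

lemma to_opp_simps:
  "to_opp 0 = 0" "to_opp 1 = 1" "to_opp (a + b) = to_opp a + to_opp b"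
  "to_opp (a - b) = to_opp a - to_opp b"
  "to_opp (a * b) = to_opp b * to_opp a" "to_opp (inverse a) = inverse (to_opp a)"
  by (simp_all add: opp_defs)

lemma to_opp_eq_0_iff [simp]: "to_opp a = 0 \<longleftrightarrow> a = 0"
  by (simp add: opp_eq_iff zero_opp_def)

lemma of_opp_eq_0_iff [simp]: "of_opp a = 0 \<longleftrightarrow> a = 0"
  by (simp add: opp_eq_iff zero_opp_def)

lemma of_opp_simps:
  "of_opp 0 = 0" "of_opp 1 = 1" "of_opp (a + b) = of_opp a + of_opp b"
  "of_opp (a - b) = of_opp a - of_opp b"
  "of_opp (a * b) = of_opp b * of_opp a" "of_opp (inverse a) = inverse (of_opp a)"
  by (simp_all add: opp_defs)

lemma to_opp_commute: "a * b = b * a \<Longrightarrow> to_opp a * to_opp b = to_opp b * to_opp a"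
  by (simp add: times_opp_def)

lemma to_opp_power: "to_opp (a ^ n) = to_opp a ^ n"
  by (induction n) (simp_all add: to_opp_simps power_Suc2 flip: power_Suc)

lemma to_opp_sum: "to_opp (\<Sum>i\<in>I. f i) = (\<Sum>i\<in>I. to_opp (f i))"
  by (induction I rule: infinite_finite_induct) (simp_all add: to_opp_simps)

definition opp_poly :: "(nat \<Rightarrow>\<^sub>0 'a::division_ring) \<Rightarrow> (nat \<Rightarrow>\<^sub>0 'a opp)"
  where "opp_poly f = Poly_Mapping.map to_opp f"

lemma coeff_opp_poly [simp]: "coeff (opp_poly f) j = to_opp (coeff f j)"
  by (simp add: opp_poly_def map.rep_eq when_def)

lemma opp_poly_inject [simp]: "opp_poly f = opp_poly g \<longleftrightarrow> f = g"
proof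
  assume "opp_poly f = opp_poly g"
  then have "to_opp (coeff f j) = to_opp (coeff g j)" for j by (metis coeff_opp_poly)
  then show "f = g" by (intro poly_mapping_eqI) (simp add: to_opp_inject)
qed simp

lemma opp_poly_surj: "\<exists>f. g = opp_poly f"
  by (rule exI[of _ "Poly_Mapping.map of_opp g"], rule poly_mapping_eqI)
    (simp add: map.rep_eq when_def)

lemma keys_opp_poly [simp]: "Poly_Mapping.keys (opp_poly f) = Poly_Mapping.keys f"
  by (auto simp: in_keys_iff)

lemma deg_opp_poly [simp]: "deg (opp_poly f) = deg f"
  by (simp add: Poly_Mapping.degree_def)

lemma opp_poly_add: "opp_poly (f + g) = opp_poly f + opp_poly g"
  and opp_poly_diff: "opp_poly (f - g) = opp_poly f - opp_poly g"
  and opp_poly_0 [simp]: "opp_poly 0 = 0"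
  and opp_poly_1 [simp]: "opp_poly 1 = 1"
  and opp_poly_Const: "opp_poly (Const c) = Const (to_opp c)"
  and opp_poly_Z: "opp_poly Z = Z"
  by (rule poly_mapping_eqI; simp add: lookup_add lookup_minus lookup_one coeff_Const Z_def lookup_single
        when_def to_opp_simps)+

lemma opp_poly_mult: "opp_poly (f * g) = opp_poly g * opp_poly f"
proof (rule poly_mapping_eqI)
  fix n
  have "(\<Sum>i\<le>n. coeff f i * coeff g (n - i)) = (\<Sum>i\<le>n. coeff f (n - i) * coeff g i)"
    by (rule sum.reindex_bij_witness[of _ "\<lambda>i. n - i" "\<lambda>i. n - i"]) auto
  then show "coeff (opp_poly (f * g)) n = coeff (opp_poly g * opp_poly f) n"
    by (simp add: coeff_mult to_opp_sum to_opp_simps)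
qed

lemma opp_poly_sum: "opp_poly (\<Sum>i\<in>I. f i) = (\<Sum>i\<in>I. opp_poly (f i))"
  by (induction I rule: infinite_finite_induct) (simp_all add: opp_poly_add)

lemmas opp_poly_simps = opp_poly_add opp_poly_diff opp_poly_Const opp_poly_Z opp_poly_mult

lemma monic_opp_poly [simp]: "monic (opp_poly f) \<longleftrightarrow> monic f"
  by (simp add: monic_def opp_eq_iff of_opp_simps)

lemma eval_l_opp: "eval_l (opp_poly f) (to_opp a) = to_opp (eval_r f a)"
  by (simp add: eval_l_def eval_r_def to_opp_sum to_opp_simps to_opp_power)

lemma eval_r_opp: "eval_r f a = of_opp (eval_l (opp_poly f) (to_opp a))"
  by (simp add: eval_l_opp)

lemma eval_r_add: "eval_r (f + g) a = eval_r f a + eval_r g a"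
  by (simp add: eval_r_opp opp_poly_add eval_l_add of_opp_simps)

lemma eval_r_diff: "eval_r (f - g) a = eval_r f a - eval_r g a"
  by (simp add: eval_r_opp opp_poly_diff eval_l_diff of_opp_simps)

lemma eval_r_sum: "eval_r (\<Sum>i\<in>I. f i) a = (\<Sum>i\<in>I. eval_r (f i) a)"
  by (induction I rule: infinite_finite_induct) (simp_all add: eval_r_add, simp_all add: eval_r_def)

lemma eval_r_Const [simp]: "eval_r (Const c) a = c"
  by (simp add: eval_r_opp opp_poly_Const)

lemma eval_r_0 [simp]: "eval_r 0 a = 0"
  by (metis Const_0 eval_r_Const)

lemma eval_r_Const_mult: "eval_r (Const c * f) a = c * eval_r f a"
  by (simp add: eval_r_opp opp_poly_simps eval_l_mult_Const of_opp_simps)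

lemma eval_r_mult_Const_central:
  "a * c = c * a \<Longrightarrow> eval_r (f * Const c) a = eval_r f a * c"
  by (simp add: eval_r_opp opp_poly_simps eval_l_Const_mult_central of_opp_simps to_opp_commute)

lemma eval_r_mult: "eval_r (f * g) a = eval_r (f * Const (eval_r g a)) a"
  using eval_l_mult[of "opp_poly g" "opp_poly f" "to_opp a"]
  by (simp add: eval_r_opp opp_poly_simps)

lemma eval_r_mult_eq_0: "eval_r g a = 0 \<Longrightarrow> eval_r (f * g) a = 0"
  by (subst eval_r_mult) simp

lemma eval_r_mult_linear: "eval_r (f * (Z - Const a)) a = 0"
  by (simp add: eval_r_opp opp_poly_simps eval_l_linear_mult)

text \<open>
  This is where \<open>x \<mapsto> a * x - x * b\<close> comes from: a left linear factor acts on right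
  values at \<open>b\<close> by the negative of this operator.
\<close>

lemma eval_r_linear_mult:
  "eval_r ((Z - Const a) * g) b = eval_r g b * b - a * eval_r g b"
proof -
  have "eval_r (g * Z) b = eval_r g b * b"
    using eval_r_mult_linear[of g b]
    by (simp add: right_diff_distrib eval_r_diff eval_r_mult_Const_central)
  then show ?thesis
    by (simp add: left_diff_distrib eval_r_diff Z_commute eval_r_Const_mult)
qed

section \<open>Polynomials vanishing on a finite set\<close>

lemma right_multiple_small:
  fixes p h :: "nat \<Rightarrow>\<^sub>0 'a::division_ring"
  assumes "f = p * h" "deg f < deg p" shows "f = 0"
proof (rule ccontr)
  assume "f \<noteq> 0"
  then have "p \<noteq> 0" "h \<noteq> 0" using assms by auto
  then have "Suc (deg f) = deg p + deg h" using deg_mult[of p h] assms(1) by simp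
  then show False using assms(2) deg_pos[OF \<open>h \<noteq> 0\<close>] by linarith
qed

text \<open>
  The property that \<open>P_l\<close> selects. Naming it separates the existence of a generator, by
  induction on \<open>D\<close>, from its uniqueness, which makes the description in \<open>P_l\<close> denote.
\<close>

definition left_generator :: "'a::division_ring set \<Rightarrow> (nat \<Rightarrow>\<^sub>0 'a) \<Rightarrow> bool"
  where "left_generator D p \<longleftrightarrow> monic p \<and> (\<forall>f. (\<forall>a\<in>D. eval_l f a = 0) \<longleftrightarrow> (\<exists>h. f = p * h))"

lemma left_generatorD:
  "left_generator D p \<Longrightarrow> (\<forall>a\<in>D. eval_l f a = 0) \<longleftrightarrow> (\<exists>h. f = p * h)"
  by (simp add: left_generator_def)

lemma left_generator_eval: "left_generator D p \<Longrightarrow> \<forall>a\<in>D. eval_l p a = 0"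
  unfolding left_generatorD by (rule exI[of _ 1]) simp

lemma left_generator_unique:
  assumes "left_generator D p" "left_generator D q" shows "p = q"
proof -
  obtain h where h: "p = q * h"
    using left_generatorD[OF assms(2), of p] left_generator_eval[OF assms(1)] by blast
  obtain k where k: "q = p * k"
    using left_generatorD[OF assms(1), of q] left_generator_eval[OF assms(2)] by blast
  have m: "monic p" "monic q" using assms by (auto simp: left_generator_def)
  then have "p \<noteq> 0" "q \<noteq> 0" by (auto dest: monic_nonzero)
  then have d: "deg p = deg q"
    using right_multiple_small[OF h] right_multiple_small[OF k] by (meson linorder_neqE_nat)
  have "p - q = q * (h - 1)" using h by (simp add: algebra_simps)
  then have "p - q = 0" using deg_monic_diff_less[OF m d] d by (intro right_multiple_small) auto
  then show ?thesis by simp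
qed

lemma left_generator_empty: "left_generator {} 1"
  by (simp add: left_generator_def monic_1)

lemma eval_l_mult_nonzero:
  assumes "eval_l p a = u" "u \<noteq> 0"
  shows "eval_l (p * h) a = u * eval_l h (inverse u * a * u)"
  unfolding eval_l_mult[of p h] assms(1)
  by (rule eval_l_mult_conj) (simp add: assms(2) mult.assoc[symmetric])

text \<open>
  A multiple \<open>p * h\<close> takes at \<open>a\<close> the value \<open>u * eval_l h (inverse u * a * u)\<close>. For \<open>u \<noteq> 0\<close> it vanishes
  exactly if \<open>h\<close> is a right multiple of the linear polynomial at the conjugate point.
\<close>

lemma left_generator_insert:
  fixes p :: "nat \<Rightarrow>\<^sub>0 'a::division_ring" and a :: 'a
  assumes "left_generator D p"
  defines "u \<equiv> eval_l p a"
  shows "left_generator (insert a D) (if u = 0 then p else p * (Z - Const (inverse u * a * u)))"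
proof (cases "u = 0")
  case True
  then have "eval_l (p * h) a = 0" for h by (simp add: u_def eval_l_mult_eq_0)
  then show ?thesis using assms True by (auto simp: left_generator_def)
next
  case False
  define a' where "a' = inverse u * a * u"
  have "(\<forall>b\<in>insert a D. eval_l f b = 0) \<longleftrightarrow> (\<exists>h. f = p * (Z - Const a') * h)" for f
  proof -
    have "(\<forall>b\<in>insert a D. eval_l f b = 0) \<longleftrightarrow> (\<exists>h. f = p * h) \<and> eval_l f a = 0"
      using assms by (auto simp: left_generator_def)
    also have "\<dots> \<longleftrightarrow> (\<exists>h. f = p * h \<and> eval_l h a' = 0)"
      using eval_l_mult_nonzero[of p a u] False by (auto simp: u_def a'_def)
    also have "\<dots> \<longleftrightarrow> (\<exists>h. f = p * (Z - Const a') * h)"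
      unfolding eval_l_eq_0_iff by (auto simp: mult.assoc)
    finally show ?thesis .
  qed
  then show ?thesis
    using assms False by (auto simp: left_generator_def monic_mult monic_linear a'_def)
qed

lemma left_generator_iff:
  "left_generator D p \<longleftrightarrow> monic p \<and> {f. \<forall>a\<in>D. eval_l f a = 0} = {p * h |h. True}"
  by (simp add: left_generator_def set_eq_iff)

lemma P_l_eqI: assumes "left_generator D p" shows "P_l D = p"
  unfolding P_l_def left_generator_iff[symmetric]
  using assms by (rule the_equality) (rule left_generator_unique[OF _ assms])

lemma left_generator_P_l:
  assumes "finite D" shows "left_generator D (P_l D)"
proof -
  have "\<exists>p. left_generator D p"
    using assms
  proof induction
    case empty show ?case using left_generator_empty by blast
  next
    case (insert a D)
    then obtain p where "left_generator D p" by blast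
    then have "left_generator (insert a D) (if eval_l p a = 0 then p
        else p * (Z - Const (inverse (eval_l p a) * a * eval_l p a)))"
      by (rule left_generator_insert)
    then show ?case by blast
  qed
  then obtain p where "left_generator D p" by blast
  then show ?thesis by (simp add: P_l_eqI)
qed

lemma monic_P_l: "finite D \<Longrightarrow> monic (P_l D)"
  and eval_l_eq_0_on_iff: "finite D \<Longrightarrow> (\<forall>a\<in>D. eval_l f a = 0) \<longleftrightarrow> (\<exists>h. f = P_l D * h)"
  using left_generator_P_l[of D] by (auto simp: left_generator_def)

lemma eval_l_P_l: "finite D \<Longrightarrow> a \<in> D \<Longrightarrow> eval_l (P_l D) a = 0"
  using eval_l_eq_0_on_iff[of D "P_l D"] by (metis mult_1_right)

lemma P_l_empty [simp]: "P_l {} = 1"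
  by (rule P_l_eqI[OF left_generator_empty])

lemma P_l_insert:
  assumes "finite D"
  shows "P_l (insert a D) = (if eval_l (P_l D) a = 0 then P_l D
    else P_l D * (Z - Const (inverse (eval_l (P_l D) a) * a * eval_l (P_l D) a)))"
  by (rule P_l_eqI, rule left_generator_insert, rule left_generator_P_l, fact)

lemma deg_P_l_insert:
  assumes "finite D"
  shows "deg (P_l (insert a D)) = (if eval_l (P_l D) a = 0 then deg (P_l D) else Suc (deg (P_l D)))"
proof -
  have "Suc (deg (P_l D * (Z - Const b))) = deg (P_l D) + 2" for b
    using deg_mult[OF monic_nonzero[OF monic_P_l[OF assms]] linear_nonzero, of b]
    by (simp add: deg_linear)
  then have "deg (P_l D * (Z - Const b)) = Suc (deg (P_l D))" for b by simp
  then show ?thesis by (simp add: P_l_insert[OF assms])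
qed

lemma deg_P_l_le: "finite D \<Longrightarrow> deg (P_l D) \<le> Suc (card D)"
  by (induction rule: finite_induct) (auto simp: deg_P_l_insert)

text \<open>
  The degree of \<open>P_l D\<close> is largest possible; no point of \<open>D\<close> is a zero forced by the other points.
\<close>

definition left_independent :: "'a::division_ring set \<Rightarrow> bool"
  where "left_independent D \<longleftrightarrow> deg (P_l D) = Suc (card D)"

lemma left_independent_insert:
  assumes "finite D" "a \<notin> D"
  shows "left_independent (insert a D) \<longleftrightarrow> left_independent D \<and> eval_l (P_l D) a \<noteq> 0"
  using deg_P_l_le[OF assms(1)] assms by (auto simp: left_independent_def deg_P_l_insert)

lemma left_independent_remove:
  assumes "finite D" "left_independent D" "a \<in> D"
  shows "left_independent (D - {a})" "eval_l (P_l (D - {a})) a \<noteq> 0"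
  using left_independent_insert[of "D - {a}" a] assms by (simp_all add: insert_absorb)

text \<open>
  If \<open>a\<close> is the last point added, the last linear factor of \<open>P_l D\<close> has a conjugate of \<open>a\<close> as its
  root; the constant \<open>inverse u\<close> moved
  past it brings the root back to \<open>a\<close> itself.
\<close>

lemma P_l_remove:
  assumes "finite D" "left_independent D" "a \<in> D"
  defines "u \<equiv> eval_l (P_l (D - {a})) a"
  shows "P_l D * Const (inverse u) = P_l (D - {a}) * Const (inverse u) * (Z - Const a)"
proof -
  have u: "u \<noteq> 0" unfolding u_def by (rule left_independent_remove(2)[OF assms(1-3)])
  have "P_l D = P_l (D - {a}) * (Z - Const (inverse u * a * u))"
    using P_l_insert[of "D - {a}" a] assms(1,3) u by (simp add: insert_absorb flip: u_def)
  moreover have "(Z - Const (inverse u * a * u)) * Const (inverse u) = Const (inverse u) * (Z - Const a)"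
    by (rule linear_mult_Const) (simp add: u mult.assoc)
  ultimately show ?thesis by (simp add: mult.assoc)
qed

text \<open>
  If \<open>D\<close> is built up point by point, each new point \<open>a\<close> is separated from the earlier ones by some \<open>f\<close>,
  which is a multiple of their generator; hence the generator does not vanish at \<open>a\<close>.
\<close>

lemma left_independentI:
  assumes "finite D" and "\<And>a. a \<in> D \<Longrightarrow> \<exists>f. eval_l f a \<noteq> 0 \<and> (\<forall>b\<in>D - {a}. eval_l f b = 0)"
  shows "left_independent D"
  using assms
proof (induction rule: finite_induct)
  case empty show ?case by (simp add: left_independent_def)
next
  case (insert a D)
  obtain f where f: "eval_l f a \<noteq> 0" "\<forall>b\<in>D. eval_l f b = 0"
    using insert.prems[of a] insert.hyps by auto
  then obtain h where "f = P_l D * h" using eval_l_eq_0_on_iff insert.hyps by blast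
  then have "eval_l (P_l D) a \<noteq> 0" using f eval_l_mult_eq_0 by blast
  moreover have "left_independent D"
  proof (rule insert.IH)
    fix b assume "b \<in> D"
    then show "\<exists>f. eval_l f b \<noteq> 0 \<and> (\<forall>c\<in>D - {b}. eval_l f c = 0)"
      using insert.prems[of b] by auto
  qed
  ultimately show ?case by (simp add: left_independent_insert insert.hyps)
qed

definition lagrange_l :: "'a::division_ring set \<Rightarrow> 'a \<Rightarrow> (nat \<Rightarrow>\<^sub>0 'a)"
  where "lagrange_l D a = P_l (D - {a}) * Const (inverse (eval_l (P_l (D - {a})) a))"

lemma eval_lagrange_l:
  assumes "finite D" "left_independent D" "a \<in> D" "b \<in> D"
  shows "eval_l (lagrange_l D a) b = (if a = b then 1 else 0)"
  using left_independent_remove[OF assms(1,2), of a] assms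
  by (auto simp: lagrange_l_def eval_l_mult_Const eval_l_P_l)

lemma deg_lagrange_l_le:
  assumes "finite D" "a \<in> D" shows "deg (lagrange_l D a) \<le> card D"
  using deg_P_l_le[of "D - {a}"] deg_mult_Const_le order_trans assms card_Suc_Diff1
  unfolding lagrange_l_def by (metis finite_Diff)

lemma left_interpolation_unique:
  assumes "finite D" "left_independent D" "deg f \<le> card D" "deg g \<le> card D"
    and "\<And>a. a \<in> D \<Longrightarrow> eval_l f a = eval_l g a"
  shows "f = g"
proof -
  have "\<forall>a\<in>D. eval_l (f - g) a = 0" using assms(5) by (simp add: eval_l_diff)
  then obtain h where "f - g = P_l D * h" using eval_l_eq_0_on_iff assms(1) by blast
  moreover have "deg (f - g) < deg (P_l D)"
    using deg_diff_le[OF assms(3,4)] assms(2) by (simp add: left_independent_def)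
  ultimately have "f - g = 0" by (rule right_multiple_small)
  then show ?thesis by simp
qed

lemma left_interpolation:
  assumes "finite D" "left_independent D"
  shows "\<exists>f. deg f \<le> card D \<and> (\<forall>a\<in>D. eval_l f a = c a)"
proof (intro exI conjI ballI)
  let ?f = "\<Sum>a\<in>D. lagrange_l D a * Const (c a)"
  show "deg ?f \<le> card D"
    by (intro deg_sum_le order_trans[OF deg_mult_Const_le] deg_lagrange_l_le assms)
  fix b assume "b \<in> D"
  then have "eval_l ?f b = (\<Sum>a\<in>D. if a = b then c a else 0)"
    unfolding eval_l_sum by (intro sum.cong) (simp_all add: eval_l_mult_Const eval_lagrange_l assms)
  then show "eval_l ?f b = c b" using \<open>b \<in> D\<close> assms by simp
qed

text \<open>
  Both sides have small degree and take the value \<open>1\<close> on \<open>D\<close>. For \<open>D = {}\<close> the constant \<open>1\<close> does not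
  meet the degree bound, and the sum is \<open>0\<close>.
\<close>

lemma sum_lagrange_l:
  assumes "finite D" "left_independent D" "D \<noteq> {}"
  shows "(\<Sum>a\<in>D. lagrange_l D a) = 1"
proof (rule left_interpolation_unique[OF assms(1,2)])
  show "deg (\<Sum>a\<in>D. lagrange_l D a) \<le> card D"
    by (intro deg_sum_le deg_lagrange_l_le assms)
  show "deg (1 :: nat \<Rightarrow>\<^sub>0 'a) \<le> card D"
    using assms by (simp add: Suc_le_eq card_gt_0_iff)
  fix b assume "b \<in> D"
  then have "eval_l (\<Sum>a\<in>D. lagrange_l D a) b = (\<Sum>a\<in>D. if a = b then 1 else 0)"
    unfolding eval_l_sum by (intro sum.cong) (simp_all add: eval_lagrange_l assms)
  then show "eval_l (\<Sum>a\<in>D. lagrange_l D a) b = eval_l 1 b" using \<open>b \<in> D\<close> assms by simp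
qed

section \<open>The mirrored results for right evaluation\<close>

text \<open>
  \<open>P_r\<close> is a definite description. Under \<open>opp_poly\<close> the described property becomes that of a left
  generator of \<open>to_opp ` D\<close>, so existence and uniqueness are inherited.
\<close>

lemma opp_poly_P_r:
  assumes "finite D" shows "opp_poly (P_r D) = P_l (to_opp ` D)"
proof -
  have gen: "left_generator (to_opp ` D) (opp_poly p) \<longleftrightarrow>
      monic p \<and> {f. \<forall>a\<in>D. eval_r f a = 0} = {h * p |h. True}" for p
  proof -
    have "(\<exists>h. opp_poly f = opp_poly p * h) \<longleftrightarrow> (\<exists>h. f = h * p)" for f
      by (metis opp_poly_inject opp_poly_mult opp_poly_surj)
    moreover have "(\<forall>f. Q f) \<longleftrightarrow> (\<forall>f. Q (opp_poly f))" for Q :: "(nat \<Rightarrow>\<^sub>0 'a opp) \<Rightarrow> bool"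
      by (metis opp_poly_surj)
    ultimately show ?thesis
      by (simp add: left_generator_def eval_l_opp set_eq_iff)
  qed
  obtain p where p: "P_l (to_opp ` D) = opp_poly p" using opp_poly_surj by blast
  have "left_generator (to_opp ` D) (opp_poly p)"
    using left_generator_P_l[of "to_opp ` D"] p assms by simp
  moreover have "q = p" if "left_generator (to_opp ` D) (opp_poly q)" for q
    using P_l_eqI[OF that] p by simp
  ultimately have "P_r D = p"
    unfolding P_r_def gen[symmetric] by (intro the_equality)
  then show ?thesis using p by simp
qed

lemma to_opp_image_remove: "to_opp ` (D - {a}) = to_opp ` D - {to_opp a}"
  by (auto simp: to_opp_inject)

lemma card_to_opp_image [simp]: "card (to_opp ` D) = card D"
  by (simp add: card_image inj_on_def to_opp_inject)

definition right_independent :: "'a::division_ring set \<Rightarrow> bool"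
  where "right_independent D \<longleftrightarrow> deg (P_r D) = Suc (card D)"

definition lagrange_r :: "'a::division_ring set \<Rightarrow> 'a \<Rightarrow> (nat \<Rightarrow>\<^sub>0 'a)"
  where "lagrange_r D a = Const (inverse (eval_r (P_r (D - {a})) a)) * P_r (D - {a})"

lemma opp_P_r_remove:
  assumes "finite D"
  shows "P_l (to_opp ` D - {to_opp a}) = opp_poly (P_r (D - {a}))"
  using opp_poly_P_r[of "D - {a}"] assms by (simp add: to_opp_image_remove)

lemma opp_lagrange_r:
  "finite D \<Longrightarrow> opp_poly (lagrange_r D a) = lagrange_l (to_opp ` D) (to_opp a)"
  by (simp add: lagrange_l_def lagrange_r_def opp_poly_simps opp_P_r_remove eval_l_opp to_opp_simps)

lemma right_independent_opp:
  "finite D \<Longrightarrow> right_independent D \<longleftrightarrow> left_independent (to_opp ` D)"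
  by (simp add: right_independent_def left_independent_def flip: opp_poly_P_r)

lemma monic_P_r: "finite D \<Longrightarrow> monic (P_r D)"
  using monic_P_l[of "to_opp ` D"] by (simp flip: opp_poly_P_r)

lemma eval_r_P_r: "finite D \<Longrightarrow> a \<in> D \<Longrightarrow> eval_r (P_r D) a = 0"
  using eval_l_P_l[of "to_opp ` D" "to_opp a"] by (simp add: eval_l_opp flip: opp_poly_P_r)

lemma eval_r_eq_0_on_iff:
  assumes "finite D" shows "(\<forall>a\<in>D. eval_r f a = 0) \<longleftrightarrow> (\<exists>h. f = h * P_r D)"
proof -
  have "(\<forall>a\<in>D. eval_r f a = 0) \<longleftrightarrow> (\<forall>a\<in>to_opp ` D. eval_l (opp_poly f) a = 0)"
    by (simp add: eval_l_opp)
  also have "\<dots> \<longleftrightarrow> (\<exists>h. opp_poly f = opp_poly (P_r D) * h)"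
    using eval_l_eq_0_on_iff[of "to_opp ` D" "opp_poly f"] assms by (simp add: opp_poly_P_r)
  also have "\<dots> \<longleftrightarrow> (\<exists>h. f = h * P_r D)"
    by (metis opp_poly_inject opp_poly_mult opp_poly_surj)
  finally show ?thesis .
qed

lemma deg_P_r_le: "finite D \<Longrightarrow> deg (P_r D) \<le> Suc (card D)"
  using deg_P_l_le[of "to_opp ` D"] by (simp flip: opp_poly_P_r)

lemma right_independent_remove:
  assumes "finite D" "right_independent D" "a \<in> D"
  shows "eval_r (P_r (D - {a})) a \<noteq> 0"
  using left_independent_remove(2)[of "to_opp ` D" "to_opp a"] assms
  by (simp add: right_independent_opp opp_P_r_remove eval_l_opp)

lemma P_r_remove:
  assumes "finite D" "right_independent D" "a \<in> D"
  defines "u \<equiv> eval_r (P_r (D - {a})) a"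
  shows "Const (inverse u) * P_r D = (Z - Const a) * Const (inverse u) * P_r (D - {a})"
proof -
  have "opp_poly (Const (inverse u) * P_r D) =
      opp_poly ((Z - Const a) * Const (inverse u) * P_r (D - {a}))"
    using P_l_remove[of "to_opp ` D" "to_opp a"] assms
    by (simp add: right_independent_opp opp_P_r_remove eval_l_opp mult.assoc
        opp_poly_simps to_opp_simps flip: opp_poly_P_r)
  then show ?thesis by (simp only: opp_poly_inject)
qed

lemma right_independentI:
  assumes "finite D" and "\<And>a. a \<in> D \<Longrightarrow> \<exists>f. eval_r f a \<noteq> 0 \<and> (\<forall>b\<in>D - {a}. eval_r f b = 0)"
  shows "right_independent D"
proof -
  have "left_independent (to_opp ` D)"
  proof (rule left_independentI)
    fix a assume "a \<in> to_opp ` D"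
    then obtain b where b: "a = to_opp b" "b \<in> D" by blast
    then obtain f where "eval_r f b \<noteq> 0 \<and> (\<forall>c\<in>D - {b}. eval_r f c = 0)"
      using assms(2) by blast
    then have "eval_l (opp_poly f) a \<noteq> 0 \<and> (\<forall>c\<in>to_opp ` D - {a}. eval_l (opp_poly f) c = 0)"
      by (auto simp: b eval_l_opp)
    then show "\<exists>f. eval_l f a \<noteq> 0 \<and> (\<forall>c\<in>to_opp ` D - {a}. eval_l f c = 0)" by blast
  qed (use assms in simp)
  then show ?thesis using assms by (simp add: right_independent_opp)
qed

lemma sum_lagrange_r:
  assumes "finite D" "right_independent D" "D \<noteq> {}"
  shows "(\<Sum>a\<in>D. lagrange_r D a) = 1"
proof -
  have "opp_poly (\<Sum>a\<in>D. lagrange_r D a) = (\<Sum>a\<in>to_opp ` D. lagrange_l (to_opp ` D) a)"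
    using assms(1) by (simp add: opp_poly_sum opp_lagrange_r sum.reindex inj_on_def to_opp_inject)
  also have "\<dots> = opp_poly 1"
    using assms by (simp add: sum_lagrange_l right_independent_opp)
  finally show ?thesis by (simp only: opp_poly_inject)
qed

lemma right_interpolation:
  assumes "finite D" "right_independent D"
  shows "\<exists>f. deg f \<le> card D \<and> (\<forall>a\<in>D. eval_r f a = c a)"
proof -
  obtain g where g: "deg g \<le> card D" "\<forall>a\<in>to_opp ` D. eval_l g a = to_opp (c (of_opp a))"
    using left_interpolation[of "to_opp ` D" "\<lambda>a. to_opp (c (of_opp a))"] assms
    by (auto simp: right_independent_opp)
  obtain f where "g = opp_poly f" using opp_poly_surj by blast
  then show ?thesis using g by (intro exI[of _ f]) (simp add: eval_l_opp to_opp_inject)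
qed

section \<open>Central polynomials and minimal polynomials\<close>

lemma ring_center_iff: "c \<in> ring_center \<longleftrightarrow> (\<forall>x. c * x = x * c)"
  by (simp add: ring_center_def)

text \<open>
  Coefficientwise centrality is the same as commuting with all constants, a form in which closure
  under sums and products is plain.
\<close>

lemma central_poly_iff: "central_poly p \<longleftrightarrow> (\<forall>c. Const c * p = p * Const c)"
  by (auto simp: central_poly_def ring_center_iff poly_mapping_eq_iff fun_eq_iff
      coeff_Const_mult coeff_mult_Const)

lemma central_poly_diff: "central_poly p \<Longrightarrow> central_poly q \<Longrightarrow> central_poly (p - q)"
  by (simp add: central_poly_iff algebra_simps)

lemma central_poly_add: "central_poly p \<Longrightarrow> central_poly q \<Longrightarrow> central_poly (p + q)"
  by (simp add: central_poly_iff algebra_simps)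

lemma central_poly_mult: "central_poly p \<Longrightarrow> central_poly q \<Longrightarrow> central_poly (p * q)"
  unfolding central_poly_iff by (metis mult.assoc)

lemma central_poly_Const: "c \<in> ring_center \<Longrightarrow> central_poly (Const c)"
  by (simp add: central_poly_iff ring_center_iff flip: Const_mult)

lemma central_poly_Z_power: "central_poly (Z ^ n)"
  by (simp add: central_poly_iff flip: single_eq_Const_mult single_eq_mult_Const)

lemma inverse_in_center:
  "c \<in> ring_center \<Longrightarrow> inverse c \<in> ring_center"
  by (simp add: ring_center_iff mult_commute_imp_mult_inverse_commute)

lemma eval_l_central_mult:
  assumes "central_poly q" shows "eval_l (p * q) a = eval_l q a * eval_l p a"
  using assms by (simp add: eval_l_mult[of p q] central_poly_iff eval_l_mult_Const)

lemma eval_r_central: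
  assumes "central_poly p" shows "eval_r p a = eval_l p a"
  unfolding eval_r_def eval_l_def
  using assms by (intro sum.cong) (auto simp: central_poly_def ring_center_iff)

lemma eval_r_central_mult_Const:
  "central_poly p \<Longrightarrow> eval_r (p * Const c) a = c * eval_l p a"
  by (metis central_poly_iff eval_r_Const_mult eval_r_central)

lemma monic_scale:
  assumes "f \<noteq> 0"
  shows "monic (Const (inverse (coeff f (deg f - 1))) * f)"
  using lead_coeff_nonzero[OF assms] by (simp add: monic_def deg_Const_mult coeff_Const_mult)

text \<open>
  A central annihilating polynomial of least degree can be made monic inside the center; the
  difference of two such would have smaller degree and still annihilate.
\<close>

lemma min_poly_exists:
  assumes "algebraic_over_center a"
  shows "\<exists>!p. monic p \<and> central_poly p \<and> eval_l p a = 0 \<and>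
    (\<forall>q. q \<noteq> 0 \<and> central_poly q \<and> eval_l q a = 0 \<longrightarrow> deg p \<le> deg q)"
proof -
  define R where "R q \<longleftrightarrow> q \<noteq> 0 \<and> central_poly q \<and> eval_l q a = 0" for q
  obtain q where q: "R q" "\<And>q'. R q' \<Longrightarrow> deg q \<le> deg q'"
    using assms ex_has_least_nat[of R _ deg] unfolding algebraic_over_center_def R_def by blast
  define c where "c = inverse (coeff q (deg q - 1))"
  have c: "c \<in> ring_center" "c \<noteq> 0"
    using q lead_coeff_nonzero[of q] by (auto simp: c_def R_def central_poly_def intro: inverse_in_center)
  let ?s = "Const c * q"
  have s: "monic ?s" "central_poly ?s" "eval_l ?s a = 0" "deg ?s = deg q"
    using q(1) c monic_scale[of q] central_poly_mult[OF central_poly_Const]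
    by (auto simp: c_def R_def eval_l_central_mult deg_Const_mult)
  show ?thesis
    unfolding R_def[symmetric]
  proof (rule ex1I[of _ ?s])
    show "monic ?s \<and> central_poly ?s \<and> eval_l ?s a = 0 \<and> (\<forall>q'. R q' \<longrightarrow> deg ?s \<le> deg q')"
      using q(2) s by simp
    fix p assume p: "monic p \<and> central_poly p \<and> eval_l p a = 0 \<and> (\<forall>q. R q \<longrightarrow> deg p \<le> deg q)"
    then have "R p" using monic_nonzero by (auto simp: R_def)
    then have "deg p = deg ?s"
      using p q s(4) by (simp add: order_antisym)
    then have "deg (p - ?s) < deg p" using p s by (intro deg_monic_diff_less) auto
    then have "\<not> R (p - ?s)" using p by (metis not_le)
    moreover have "central_poly (p - ?s)" "eval_l (p - ?s) a = 0"
      using p s by (auto intro: central_poly_diff simp: eval_l_diff)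
    ultimately show "p = ?s" by (auto simp: R_def)
  qed
qed

lemma
  assumes "algebraic_over_center a"
  shows monic_min_poly: "monic (min_poly a)"
    and central_min_poly: "central_poly (min_poly a)"
    and eval_min_poly: "eval_l (min_poly a) a = 0"
    and min_poly_least: "q \<noteq> 0 \<Longrightarrow> central_poly q \<Longrightarrow> eval_l q a = 0 \<Longrightarrow> deg (min_poly a) \<le> deg q"
  using theI'[OF min_poly_exists[OF assms]] unfolding min_poly_def[symmetric] by blast+

lemma min_poly_factor:
  assumes "algebraic_over_center a"
  shows "min_poly a = (Z - Const a) * L_quot a (min_poly a)"
  using L_quot_eq[of "min_poly a" a] eval_min_poly[OF assms] by simp

lemma eval_central_conj:
  assumes "central_poly p" "a * x = x * b"
  shows "eval_l p a * x = x * eval_l p b"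
  using eval_l_mult_conj[OF assms(2), of p] assms(1)
  by (simp add: central_poly_iff eval_l_mult_Const)

section \<open>The equation \<open>a * x - x * b = c\<close>\<close>

text \<open>
  Conjugacy written without inverses: \<open>a = x * b * inverse x\<close> says that \<open>x\<close> is a nonzero kernel
  element of \<open>x \<mapsto> a * x - x * b\<close>.
\<close>

definition conjugate :: "'a::division_ring \<Rightarrow> 'a \<Rightarrow> bool"
  where "conjugate a b \<longleftrightarrow> (\<exists>x. x \<noteq> 0 \<and> a * x = x * b)"

text \<open>
  Multiply \<open>min_poly a = (Z - a) * L\<close> by \<open>Const c\<close> and take right values at \<open>b\<close>. Since the minimal
  polynomial is central, the left-hand side gives \<open>c\<close> times its value at \<open>b\<close>, while the right-hand side
  is \<open>y * b - a * y\<close> with \<open>y = eval_r (L * Const c) b\<close>. Up to sign, \<open>Psi a b c\<close> is \<open>y\<close> divided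
  by the value of the minimal polynomial at \<open>b\<close>, which commutes with \<open>b\<close>.
\<close>

lemma Psi_sylvester:
  assumes "algebraic_over_center a" "eval_l (min_poly a) b \<noteq> 0"
  shows "a * Psi a b c - Psi a b c * b = c"
proof -
  define X where "X = eval_l (min_poly a) b"
  define y where "y = eval_r (L_quot a (min_poly a) * Const c) b"
  have "y * b - a * y = eval_r (min_poly a * Const c) b"
    unfolding y_def by (subst (3) min_poly_factor[OF assms(1)])
      (simp only: mult.assoc eval_r_linear_mult)
  also have "\<dots> = c * X"
    using central_min_poly[OF assms(1)] by (simp add: eval_r_central_mult_Const X_def)
  finally have y: "y * b - a * y = c * X" .
  have "X * b = b * X"
    using eval_central_conj[OF central_min_poly[OF assms(1)], of b b b] by (simp add: X_def)
  then have "inverse X * b = b * inverse X"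
    by (rule mult_commute_imp_mult_inverse_commute)
  then have "a * - (y * inverse X) - - (y * inverse X) * b = (y * b - a * y) * inverse X"
    by (simp add: algebra_simps)
  also have "\<dots> = c" using y assms(2) by (simp add: X_def mult.assoc)
  finally show ?thesis by (simp add: Psi_def X_def y_def)
qed

text \<open>
  Among all central \<open>q\<close> take one that makes the degree of \<open>r = f - m * q\<close> least. Were that degree not
  below \<open>deg m\<close>, subtracting a suitable central monomial multiple of \<open>m\<close> from \<open>r\<close> would lower it.
\<close>

lemma central_division:
  assumes "monic m" "central_poly m" "central_poly f"
  shows "\<exists>q. central_poly q \<and> deg (f - m * q) < deg m"
proof -
  obtain q where q: "central_poly q"
    and q_least: "\<And>q'. central_poly q' \<Longrightarrow> deg (f - m * q) \<le> deg (f - m * q')"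
    using ex_has_least_nat[of central_poly 0 "\<lambda>q. deg (f - m * q)"]
    by (auto simp: central_poly_iff)
  define r where "r = f - m * q"
  show ?thesis
  proof (rule ccontr)
    assume "\<nexists>q. central_poly q \<and> deg (f - m * q) < deg m"
    then have le: "deg m \<le> deg r" using q by (auto simp: r_def not_less)
    have m0: "deg m > 0" using assms(1) monic_nonzero deg_pos by blast
    define c where "c = coeff r (deg r - 1)"
    define q' where "q' = Const c * Z ^ (deg r - deg m)"
    have "central_poly r" using assms q by (auto simp: r_def intro: central_poly_diff central_poly_mult)
    then have "central_poly q'"
      by (auto simp: q'_def c_def central_poly_def[of r] intro: central_poly_mult central_poly_Const central_poly_Z_power)
    have q's: "q' = Poly_Mapping.single (deg r - deg m) c"
      by (simp add: q'_def single_eq_Const_mult)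
    have "m * q' = q' * m"
    proof -
      have "m * Z ^ n = Z ^ n * m" for n
        by (induction n) (simp_all add: mult.assoc Z_commute, simp add: mult.assoc[symmetric])
      then show ?thesis using assms(2) unfolding q'_def central_poly_iff by (metis mult.assoc)
    qed
    then have "coeff (r - m * q') j = 0" if "deg r - 1 \<le> j" for j
      using that le m0 assms(1)
      by (cases "j = deg r - 1")
        (auto simp: lookup_minus q's coeff_single_mult beyond_degree_lookup_zero c_def monic_def)
    then have "deg (r - m * q') \<le> deg r - 1" by (simp add: deg_le_iff)
    moreover have "r - m * q' = f - m * (q + q')" by (simp add: r_def algebra_simps)
    moreover have "central_poly (q + q')" using q \<open>central_poly q'\<close> by (rule central_poly_add)
    ultimately have "deg (f - m * q) \<le> deg r - 1" using q_least[of "q + q'"] by (metis order_trans)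
    then show False using le m0 by (simp add: r_def)
  qed
qed

text \<open>
  Let \<open>I\<close> hold for the nonzero \<open>f\<close> with \<open>eval_r (f * y) b = 0\<close> for all constants \<open>y\<close>, and suppose that
  it holds for the quotient \<open>L\<close> of the minimal polynomial \<open>X\<close> of \<open>a\<close>. Together with \<open>0\<close> these \<open>f\<close> are
  closed under differences and under multiplication by constants on both sides, so a monic \<open>m\<close> of least
  degree among them commutes with all constants: it is central. It vanishes at \<open>b\<close>, and its degree is
  below that of \<open>X\<close>, because that of \<open>L\<close> is. It divides \<open>X\<close>, by the minimality of \<open>m\<close>, and one of the two central factors of \<open>X\<close>
  vanishes at \<open>a\<close>. By the minimality of \<open>X\<close> this factor is not \<open>m\<close>, and it is the cofactor only if
  \<open>m = 1\<close>, which does not vanish at \<open>b\<close>.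
\<close>

lemma L_quot_min_poly_nonvanishing:
  assumes alg: "algebraic_over_center a" and root: "eval_l (min_poly a) b = 0"
  shows "\<exists>y. eval_r (L_quot a (min_poly a) * Const y) b \<noteq> 0"
proof (rule ccontr)
  define X where "X = min_poly a"
  define L where "L = L_quot a X"
  define I where "I f \<longleftrightarrow> f \<noteq> 0 \<and> (\<forall>y. eval_r (f * Const y) b = 0)" for f
  note X = monic_min_poly[OF alg, folded X_def] central_min_poly[OF alg, folded X_def]
    eval_min_poly[OF alg, folded X_def] min_poly_least[OF alg, folded X_def]
  have XL: "X = (Z - Const a) * L" using min_poly_factor[OF alg] by (simp add: X_def L_def)
  assume "\<nexists>y. eval_r (L_quot a (min_poly a) * Const y) b \<noteq> 0"
  moreover have "L \<noteq> 0" using XL monic_nonzero[OF X(1)] by auto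
  ultimately have "I L" by (simp add: I_def L_def X_def)
  then obtain m0 where m0: "I m0" "\<And>f. I f \<Longrightarrow> deg m0 \<le> deg f"
    using ex_has_least_nat[of I L deg] by blast
  define m where "m = Const (inverse (coeff m0 (deg m0 - 1))) * m0"
  have "inverse (coeff m0 (deg m0 - 1)) \<noteq> 0" using m0(1) lead_coeff_nonzero[of m0] by (simp add: I_def)
  then have "deg m = deg m0" "I m" "monic m"
    using m0(1) monic_scale[of m0]
    by (auto simp: m_def I_def deg_Const_mult mult.assoc eval_r_Const_mult)
  have least: "deg m \<le> deg f" if "I f" for f
    using m0(2)[OF that] \<open>deg m = deg m0\<close> by simp
  have "Const c * m = m * Const c" for c
  proof (rule ccontr)
    assume ne: "Const c * m \<noteq> m * Const c"
    have "coeff (Const c * m - m * Const c) j = 0" if "deg m - 1 \<le> j" for j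
      using that \<open>monic m\<close>
      by (cases "j = deg m - 1")
        (auto simp: lookup_minus coeff_Const_mult coeff_mult_Const beyond_degree_lookup_zero monic_def)
    then have "deg (Const c * m - m * Const c) \<le> deg m - 1" by (simp add: deg_le_iff)
    also have "\<dots> < deg m" using \<open>I m\<close> deg_pos[of m] by (simp add: I_def)
    finally have "\<not> I (Const c * m - m * Const c)" using least by (metis not_le)
    moreover have "eval_r ((Const c * m - m * Const c) * Const y) b = 0" for y
      using \<open>I m\<close> by (simp add: I_def left_diff_distrib eval_r_diff mult.assoc eval_r_Const_mult
          flip: Const_mult)
    ultimately show False using ne by (simp add: I_def)
  qed
  then have cm: "central_poly m" by (simp add: central_poly_iff)
  have mb: "eval_l m b = 0"
  proof -
    have "eval_r (m * Const 1) b = 0" using \<open>I m\<close> unfolding I_def by blast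
    then show ?thesis by (simp add: eval_r_central_mult_Const[OF cm] del: Const_1)
  qed
  have "Suc (deg X) = Suc (Suc (deg L))"
    using deg_mult[OF linear_nonzero \<open>L \<noteq> 0\<close>, of a] XL by (simp add: deg_linear)
  then have degm: "deg m < deg X" using least[OF \<open>I L\<close>] by simp
  obtain q where cq: "central_poly q" and dq: "deg (X - m * q) < deg m"
    using central_division[OF \<open>monic m\<close> cm X(2)] by blast
  have "central_poly (X - m * q)" using X(2) cm cq by (intro central_poly_diff central_poly_mult)
  moreover have "eval_l (X - m * q) b = 0"
    using root mb by (simp add: eval_l_diff eval_l_mult_eq_0 X_def)
  ultimately have "X - m * q = 0"
    using least[of "X - m * q"] dq by (auto simp: I_def eval_r_central_mult_Const)
  then have Xmq: "X = m * q" by simp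
  then have "eval_l q a = 0 \<or> eval_l m a = 0"
    using X(3) by (simp add: eval_l_central_mult[OF cq])
  moreover have nz: "m \<noteq> 0" "q \<noteq> 0" using Xmq monic_nonzero[OF X(1)] by auto
  moreover have "eval_l m a \<noteq> 0" using X(4)[OF nz(1) cm] degm by auto
  ultimately have "deg X \<le> deg q" using X(4)[OF nz(2) cq] by simp
  then have "deg m \<le> 1" using deg_mult[OF nz] Xmq by simp
  then have "deg m = 1" using deg_pos[OF nz(1)] by simp
  then have "coeff m j = coeff 1 j" for j
    using \<open>monic m\<close> beyond_degree_lookup_zero[of m j] by (cases "j = 0") (simp_all add: monic_def lookup_one)
  then have "m = 1" by (rule poly_mapping_eqI)
  then show False using mb by simp
qed

text \<open>
  If \<open>X = (Z - a) * L\<close> vanishes at \<open>b\<close>, any nonzero value \<open>y = eval_r (L * Const c) b\<close> satisfies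
  \<open>a * y = y * b\<close>. Conversely, values of a central polynomial at conjugate points are conjugate.
\<close>

lemma min_poly_root_iff_conjugate:
  assumes "algebraic_over_center a"
  shows "eval_l (min_poly a) b = 0 \<longleftrightarrow> conjugate a b"
  unfolding conjugate_def
proof
  assume root: "eval_l (min_poly a) b = 0"
  then obtain c where c: "eval_r (L_quot a (min_poly a) * Const c) b \<noteq> 0"
    using L_quot_min_poly_nonvanishing assms by blast
  let ?y = "eval_r (L_quot a (min_poly a) * Const c) b"
  have "?y * b - a * ?y = eval_r (min_poly a * Const c) b"
    by (subst (3) min_poly_factor[OF assms]) (simp only: mult.assoc eval_r_linear_mult)
  also have "\<dots> = 0" using root by (simp add: eval_r_central_mult_Const central_min_poly assms)
  finally show "\<exists>x. x \<noteq> 0 \<and> a * x = x * b" using c by (intro exI[of _ ?y]) simp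
next
  assume "\<exists>x. x \<noteq> 0 \<and> a * x = x * b"
  then obtain x where "x \<noteq> 0" "a * x = x * b" by blast
  then have "eval_l (min_poly a) a * x = x * eval_l (min_poly a) b"
    using eval_central_conj central_min_poly assms by blast
  then show "eval_l (min_poly a) b = 0" using \<open>x \<noteq> 0\<close> eval_min_poly[OF assms] by simp
qed

text \<open>
  With \<open>X = (Z - a) * L\<close>, the map \<open>S y = eval_r (L * Const y) b\<close> is not zero, but it kills the image of
  \<open>y \<mapsto> a * y - y * b\<close>. The latter holds because \<open>L\<close> commutes with \<open>a\<close>, so that
  \<open>S (a * y - y * b) = a * S y - S y * b\<close>, which is minus the right value of \<open>X * Const y\<close> at \<open>b\<close>.
\<close>

lemma sylvester_not_surjective:
  assumes alg: "algebraic_over_center a" and root: "eval_l (min_poly a) b = 0"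
  shows "\<exists>e. \<forall>y. a * y - y * b \<noteq> e"
proof -
  define L where "L = L_quot a (min_poly a)"
  define S where "S y = eval_r (L * Const y) b" for y
  note X = min_poly_factor[OF alg, folded L_def]
  note cX = central_min_poly[OF alg]
  have "(Z - Const a) * (L * Const a) = min_poly a * Const a" by (subst X) (simp add: mult.assoc)
  also have "\<dots> = Const a * min_poly a" using cX by (simp add: central_poly_iff)
  also have "\<dots> = (Z - Const a) * (Const a * L)"
    by (subst X) (simp add: algebra_simps Z_commute)
  finally have comm: "L * Const a = Const a * L" using linear_nonzero[of a] by (metis mult_left_cancel)
  have "S (a * y - y * b) = 0" for y
  proof -
    have "L * Const (a * y - y * b) = Const a * (L * Const y) - L * Const y * Const b"
      by (simp add: Const_diff Const_mult right_diff_distrib comm flip: mult.assoc)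
    then have "S (a * y - y * b) = a * S y - S y * b"
      by (simp add: S_def eval_r_diff eval_r_Const_mult eval_r_mult_Const_central)
    also have "\<dots> = - eval_r ((Z - Const a) * (L * Const y)) b"
      by (simp add: eval_r_linear_mult S_def)
    also have "\<dots> = 0"
      unfolding mult.assoc[symmetric] X[symmetric]
      using root by (simp add: eval_r_central_mult_Const[OF cX])
    finally show ?thesis .
  qed
  moreover obtain e where "S e \<noteq> 0"
    using L_quot_min_poly_nonvanishing[OF assms] by (auto simp: S_def L_def)
  ultimately show ?thesis by metis
qed

text \<open>
  Right evaluation at \<open>b\<close> of \<open>f = Const (eval_l f a) + (Z - Const a) * L_quot a f\<close>.
\<close>

lemma eval_l_minus_eval_r:
  "\<exists>y. eval_l f a - eval_r f b = a * y - y * b"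
proof
  let ?g = "L_quot a f"
  have "eval_r f b = eval_l f a + (eval_r ?g b * b - a * eval_r ?g b)"
    using arg_cong[OF L_quot_eq[of f a], of "\<lambda>f. eval_r f b"]
    by (simp add: eval_r_add eval_r_linear_mult)
  then show "eval_l f a - eval_r f b = a * eval_r ?g b - eval_r ?g b * b" by simp
qed

section \<open>Two-sided independence\<close>

text \<open>
  \<open>P_l D\<close> is a product of linear factors whose roots are conjugate to elements of \<open>D\<close>. Evaluating
  from the right, each factor turns the constant \<open>w\<close> into \<open>w * b - a' * w\<close>, which is again nonzero.
\<close>

lemma eval_r_P_l_nonzero:
  assumes "finite D" "\<And>a. a \<in> D \<Longrightarrow> \<not> conjugate a b" "w \<noteq> 0"
  shows "eval_r (P_l D * Const w) b \<noteq> 0"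
  using assms
proof (induction D arbitrary: w rule: finite_induct)
  case empty then show ?case by simp
next
  case (insert a D)
  show ?case
  proof (cases "eval_l (P_l D) a = 0")
    case True then show ?thesis using insert by (simp add: P_l_insert)
  next
    case False
    define u where "u = eval_l (P_l D) a"
    define v where "v = w * b - inverse u * a * u * w"
    have "v \<noteq> 0"
    proof
      assume "v = 0"
      then have "u * (inverse u * a * u * w) = u * (w * b)" by (simp add: v_def)
      then have "a * (u * w) = u * w * b" using False by (simp add: u_def mult.assoc[symmetric])
      then have "conjugate a b" using False insert.prems(2)
        by (auto simp: conjugate_def u_def intro!: exI[of _ "u * w"])
      then show False using insert.prems(1) by simp
    qed
    have "P_l (insert a D) * Const w = P_l D * ((Z - Const (inverse u * a * u)) * Const w)"
      using False insert.hyps by (simp add: P_l_insert mult.assoc flip: u_def)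
    then have "eval_r (P_l (insert a D) * Const w) b = eval_r (P_l D * Const v) b"
      by (simp add: eval_r_mult[of "P_l D" "(Z - _) * _"] eval_r_linear_mult v_def)
    then show ?thesis using insert.IH[OF _ \<open>v \<noteq> 0\<close>] insert.prems by simp
  qed
qed

text \<open>
  A polynomial that vanishes on \<open>\<Lambda>\<close> from the left has the form \<open>P_l \<Lambda> * h\<close>. As \<open>P_l \<Lambda>\<close> never kills a nonzero right value at a point of
  \<open>\<Omega>\<close>, already \<open>h\<close> vanishes on \<open>\<Omega>\<close> if the product does, and is then a multiple of \<open>P_r \<Omega>\<close>; the degrees of the two
  generators then add up to more than is allowed.
\<close>

lemma P_independentI:
  assumes fin: "finite \<Lambda>" "finite \<Omega>"
    and ind: "left_independent \<Lambda>" "right_independent \<Omega>"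
    and nc: "\<And>a b. a \<in> \<Lambda> \<Longrightarrow> b \<in> \<Omega> \<Longrightarrow> \<not> conjugate a b"
  shows "P_independent \<Lambda> \<Omega>"
  unfolding P_independent_def
proof safe
  fix g assume g: "g \<in> polys_below (card \<Lambda> + card \<Omega>)" "g \<noteq> 0"
    "\<forall>a\<in>\<Lambda>. eval_l g a = 0" "\<forall>b\<in>\<Omega>. eval_r g b = 0"
  obtain h where h: "g = P_l \<Lambda> * h" using g(3) eval_l_eq_0_on_iff[OF fin(1)] by blast
  have "\<forall>b\<in>\<Omega>. eval_r h b = 0"
    using g(4) eval_r_P_l_nonzero[OF fin(1) nc] h eval_r_mult[of "P_l \<Lambda>" h] by metis
  then obtain k where k: "h = k * P_r \<Omega>" using eval_r_eq_0_on_iff[OF fin(2)] by blast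
  have nz: "P_l \<Lambda> \<noteq> 0" "h \<noteq> 0" "k \<noteq> 0" "P_r \<Omega> \<noteq> 0" using g(2) h k by auto
  show False
    using deg_mult[OF nz(1,2)] deg_mult[OF nz(3,4)] deg_pos[OF nz(3)] g(1) ind h k
    by (simp add: polys_below_def left_independent_def right_independent_def)
qed

text \<open>
  Evaluation at \<open>a\<close> turns the factor \<open>P_l (\<Lambda> - {a})\<close> into a constant that cancels against \<open>\<rho>\<close>. In the
  term of \<open>b\<close>, the polynomial \<open>P_r \<Omega>\<close> supplies a factor \<open>Z - b\<close> next to \<open>x b\<close>, and
  \<open>x b * (Z - b) = (Z - a) * x b + c\<close>. The multiple of \<open>Z - a\<close> drops out; the rest is \<open>c\<close>
  times a Lagrange polynomial, and these sum to \<open>1\<close>.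
\<close>

lemma eval_l_sandwich:
  fixes \<Lambda> \<Omega> :: "'a::division_ring set"
  assumes fin: "finite \<Lambda>" "finite \<Omega>"
    and ind: "left_independent \<Lambda>" "right_independent \<Omega>" and a: "a \<in> \<Lambda>" and ne: "\<Omega> \<noteq> {}"
    and x: "\<And>b. b \<in> \<Omega> \<Longrightarrow> a * x b - x b * b = c"
  defines "\<rho> \<equiv> \<Sum>b\<in>\<Omega>. inverse (eval_l (P_l (\<Lambda> - {a})) a) * x b * inverse (eval_r (P_r (\<Omega> - {b})) b)"
  shows "eval_l (P_l (\<Lambda> - {a}) * Const \<rho> * P_r \<Omega>) a = c"
proof -
  define p where "p = eval_l (P_l (\<Lambda> - {a})) a"
  define q where "q b = eval_r (P_r (\<Omega> - {b})) b" for b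
  have "p \<noteq> 0" using left_independent_remove fin ind a by (simp add: p_def)
  then have "p * \<rho> = (\<Sum>b\<in>\<Omega>. x b * inverse (q b))"
    by (simp add: \<rho>_def sum_distrib_left q_def mult.assoc[symmetric] flip: p_def)
  then have "eval_l (P_l (\<Lambda> - {a}) * Const \<rho> * P_r \<Omega>) a = eval_l (Const (\<Sum>b\<in>\<Omega>. x b * inverse (q b)) * P_r \<Omega>) a"
    unfolding mult.assoc by (subst eval_l_mult, unfold p_def[symmetric])
      (simp flip: Const_mult mult.assoc)
  also have "\<dots> = (\<Sum>b\<in>\<Omega>. eval_l (Const (x b) * (Const (inverse (q b)) * P_r \<Omega>)) a)"
    by (simp add: Const_sum Const_mult sum_distrib_right eval_l_sum mult.assoc)
  also have "\<dots> = (\<Sum>b\<in>\<Omega>. eval_l (Const c * lagrange_r \<Omega> b) a)"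
  proof (rule sum.cong)
    fix b assume b: "b \<in> \<Omega>"
    have "Const (x b) * (Z - Const b) = (Z - Const a) * Const (x b) + Const c"
      unfolding x[OF b, symmetric] by (simp add: algebra_simps Const_diff Const_mult Z_commute)
    then have "Const (x b) * (Const (inverse (q b)) * P_r \<Omega>) =
        (Z - Const a) * (Const (x b) * lagrange_r \<Omega> b) + Const c * lagrange_r \<Omega> b"
      using P_r_remove[OF fin(2) ind(2) b]
      by (simp add: q_def lagrange_r_def distrib_right flip: mult.assoc)
    then show "eval_l (Const (x b) * (Const (inverse (q b)) * P_r \<Omega>)) a = eval_l (Const c * lagrange_r \<Omega> b) a"
      by (simp add: eval_l_add eval_l_linear_mult)
  qed simp
  also have "\<dots> = eval_l (Const c * (\<Sum>b\<in>\<Omega>. lagrange_r \<Omega> b)) a"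
    by (simp add: eval_l_sum sum_distrib_left)
  also have "\<dots> = c"
    using sum_lagrange_r[OF fin(2) ind(2) ne] by simp
  finally show ?thesis .
qed

text \<open>
  The mirror image of the preceding computation. The minus sign in \<open>\<gamma>\<close> is due to the exchange of the two
  sides: here \<open>eval_r ((Z - a) * - x a) b = a * x a - x a * b\<close>.
\<close>

lemma eval_r_sandwich:
  fixes \<Lambda> \<Omega> :: "'a::division_ring set"
  assumes fin: "finite \<Lambda>" "finite \<Omega>"
    and ind: "left_independent \<Lambda>" "right_independent \<Omega>" and b: "b \<in> \<Omega>" and ne: "\<Lambda> \<noteq> {}"
    and x: "\<And>a. a \<in> \<Lambda> \<Longrightarrow> a * x a - x a * b = d"
  defines "\<gamma> \<equiv> - (\<Sum>a\<in>\<Lambda>. inverse (eval_l (P_l (\<Lambda> - {a})) a) * x a * inverse (eval_r (P_r (\<Omega> - {b})) b))"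
  shows "eval_r (P_l \<Lambda> * Const \<gamma> * P_r (\<Omega> - {b})) b = d"
proof -
  define p where "p a = eval_l (P_l (\<Lambda> - {a})) a" for a
  define q where "q = eval_r (P_r (\<Omega> - {b})) b"
  have "q \<noteq> 0" using right_independent_remove fin ind b by (simp add: q_def)
  then have "\<gamma> * q = (\<Sum>a\<in>\<Lambda>. inverse (p a) * - x a)"
    by (simp add: \<gamma>_def sum_distrib_right p_def mult.assoc sum_negf flip: q_def)
  then have "eval_r (P_l \<Lambda> * Const \<gamma> * P_r (\<Omega> - {b})) b = eval_r (P_l \<Lambda> * Const (\<Sum>a\<in>\<Lambda>. inverse (p a) * - x a)) b"
    by (subst eval_r_mult) (simp add: mult.assoc flip: Const_mult q_def)
  also have "\<dots> = (\<Sum>a\<in>\<Lambda>. eval_r (P_l \<Lambda> * Const (inverse (p a)) * Const (- x a)) b)"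
    by (simp only: Const_sum Const_mult sum_distrib_left eval_r_sum mult.assoc)
  also have "\<dots> = (\<Sum>a\<in>\<Lambda>. eval_r (lagrange_l \<Lambda> a * Const d) b)"
  proof (rule sum.cong)
    fix a assume a: "a \<in> \<Lambda>"
    have "P_l \<Lambda> * Const (inverse (p a)) * Const (- x a) = lagrange_l \<Lambda> a * ((Z - Const a) * Const (- x a))"
      using P_l_remove[OF fin(1) ind(1) a] by (simp add: p_def lagrange_l_def mult.assoc)
    then have "eval_r (P_l \<Lambda> * Const (inverse (p a)) * Const (- x a)) b =
        eval_r (lagrange_l \<Lambda> a * Const (eval_r ((Z - Const a) * Const (- x a)) b)) b"
      using eval_r_mult by metis
    then show "eval_r (P_l \<Lambda> * Const (inverse (p a)) * Const (- x a)) b = eval_r (lagrange_l \<Lambda> a * Const d) b"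
      using x[OF a] by (simp add: eval_r_linear_mult)
  qed simp
  also have "\<dots> = eval_r ((\<Sum>a\<in>\<Lambda>. lagrange_l \<Lambda> a) * Const d) b"
    by (simp add: eval_r_sum sum_distrib_right)
  also have "\<dots> = d"
    using sum_lagrange_l[OF fin(1) ind(1) ne] by simp
  finally show ?thesis .
qed

text \<open>
  Each failure produces a nonzero polynomial that vanishes on both sets and has too small a degree.
  If one of the sets is dependent, this is \<open>P_l \<Lambda> * P_r \<Omega>\<close>. If \<open>a * x = x * b\<close> with \<open>x \<noteq> 0\<close>, it is
  the summand of the interpolation formula at \<open>a\<close> with \<open>x\<close> in place of the solution for \<open>b\<close>,
  and data \<open>c = 0\<close>.
\<close>

lemma P_independentD:
  assumes fin: "finite \<Lambda>" "finite \<Omega>" and "P_independent \<Lambda> \<Omega>"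
  shows "left_independent \<Lambda>" "right_independent \<Omega>"
    and "a \<in> \<Lambda> \<Longrightarrow> b \<in> \<Omega> \<Longrightarrow> \<not> conjugate a b"
proof -
  have no: "g = 0" if "deg g \<le> card \<Lambda> + card \<Omega>" "\<And>a. a \<in> \<Lambda> \<Longrightarrow> eval_l g a = 0"
    "\<And>b. b \<in> \<Omega> \<Longrightarrow> eval_r g b = 0" for g
    using assms(3) that unfolding P_independent_def polys_below_def by blast
  have nz: "P_l \<Lambda> \<noteq> 0" "P_r \<Omega> \<noteq> 0" using fin monic_nonzero monic_P_l monic_P_r by blast+
  have "\<not> deg (P_l \<Lambda> * P_r \<Omega>) \<le> card \<Lambda> + card \<Omega>"
    using no[of "P_l \<Lambda> * P_r \<Omega>"] nz fin
    by (auto simp: eval_l_mult_eq_0 eval_r_mult_eq_0 eval_l_P_l eval_r_P_r)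
  then show ind: "left_independent \<Lambda>" "right_independent \<Omega>"
    using deg_mult[OF nz] deg_P_l_le[OF fin(1)] deg_P_r_le[OF fin(2)]
    by (auto simp: left_independent_def right_independent_def)
  assume ab: "a \<in> \<Lambda>" "b \<in> \<Omega>"
  show "\<not> conjugate a b"
  proof
    assume "conjugate a b"
    then obtain x where x: "x \<noteq> 0" "a * x = x * b" by (auto simp: conjugate_def)
    define u where "u = eval_l (P_l (\<Lambda> - {a})) a"
    define v where "v = eval_r (P_r (\<Omega> - {b})) b"
    have uv: "u \<noteq> 0" "v \<noteq> 0"
      using left_independent_remove(2)[OF fin(1) ind(1) ab(1)]
        right_independent_remove[OF fin(2) ind(2) ab(2)] by (simp_all add: u_def v_def)
    define g where "g = P_l (\<Lambda> - {a}) * Const (inverse u * x * inverse v) * P_r \<Omega>"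
    have "P_l (\<Lambda> - {a}) \<noteq> 0" using fin monic_nonzero monic_P_l by blast
    then have "g \<noteq> 0" using nz x uv by (simp add: g_def)
    moreover have "g = 0"
    proof (rule no)
      have "deg (P_l (\<Lambda> - {a}) * Const (inverse u * x * inverse v)) \<le> Suc (card (\<Lambda> - {a}))"
        using deg_mult_Const_le deg_P_l_le fin order_trans by (metis finite_Diff)
      then show "deg g \<le> card \<Lambda> + card \<Omega>"
        using deg_mult_le[OF _ deg_P_r_le[OF fin(2)]] card_Suc_Diff1[OF fin(1) ab(1)]
        unfolding g_def by fastforce
      show "eval_r g b' = 0" if "b' \<in> \<Omega>" for b'
        using that fin by (simp add: g_def eval_r_mult_eq_0 eval_r_P_r)
      fix a' assume a': "a' \<in> \<Lambda>"
      show "eval_l g a' = 0"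
      proof (cases "a' = a")
        case False
        then show ?thesis using a' fin by (simp add: g_def mult.assoc eval_l_mult_eq_0 eval_l_P_l)
      next
        case True
        \<comment> \<open>\<open>x\<close> solves \<open>a * x - x * b = 0\<close>, and \<open>0\<close> solves the same equation for every other element of \<open>\<Omega>\<close>.\<close>
        define y where "y b' = (if b' = b then x else 0)" for b'
        have "(\<Sum>b'\<in>\<Omega>. inverse u * y b' * inverse (eval_r (P_r (\<Omega> - {b'})) b')) =
            (\<Sum>b'\<in>\<Omega>. if b' = b then inverse u * x * inverse v else 0)"
          by (intro sum.cong) (simp_all add: y_def v_def)
        then have "eval_l g a = eval_l (P_l (\<Lambda> - {a}) * Const (\<Sum>b'\<in>\<Omega>. inverse u * y b' *
            inverse (eval_r (P_r (\<Omega> - {b'})) b')) * P_r \<Omega>) a"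
          using fin(2) ab(2) by (simp add: g_def)
        also have "\<dots> = 0"
          unfolding u_def using ab x(2) by (intro eval_l_sandwich fin ind) (auto simp: y_def)
        finally show ?thesis using True by simp
      qed
    qed
    ultimately show False by simp
  qed
qed

section \<open>Two-sided interpolation\<close>

text \<open>
  Interpolating \<open>1\<close> at one point and \<open>0\<close> at the others shows that \<open>\<Lambda>\<close> and \<open>\<Omega>\<close> are independent. If
  \<open>a \<in> \<Lambda>\<close> and \<open>b \<in> \<Omega>\<close> were conjugate, the data \<open>e\<close> at \<open>a\<close> and \<open>0\<close> at \<open>b\<close> would be unattainable for
  \<open>e\<close> outside the image of \<open>y \<mapsto> a * y - y * b\<close>.
\<close>

lemma P_independent_of_solvable:
  assumes fin: "finite \<Lambda>" "finite \<Omega>" and alg: "\<And>a. a \<in> \<Lambda> \<Longrightarrow> algebraic_over_center a"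
    and solv: "\<And>c d. \<exists>f. (\<forall>a\<in>\<Lambda>. eval_l f a = c a) \<and> (\<forall>b\<in>\<Omega>. eval_r f b = d b)"
  shows "P_independent \<Lambda> \<Omega>"
proof (rule P_independentI[OF fin])
  show "left_independent \<Lambda>"
  proof (rule left_independentI[OF fin(1)])
    fix a assume "a \<in> \<Lambda>"
    moreover obtain f where "\<forall>b\<in>\<Lambda>. eval_l f b = (if b = a then 1 else 0)"
      using solv[of "\<lambda>b. if b = a then 1 else 0" "\<lambda>_. 0"] by blast
    ultimately show "\<exists>f. eval_l f a \<noteq> 0 \<and> (\<forall>b\<in>\<Lambda> - {a}. eval_l f b = 0)"
      by (intro exI[of _ f]) simp
  qed
  show "right_independent \<Omega>"
  proof (rule right_independentI[OF fin(2)])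
    fix a assume "a \<in> \<Omega>"
    moreover obtain f where "\<forall>b\<in>\<Omega>. eval_r f b = (if b = a then 1 else 0)"
      using solv[of "\<lambda>_. 0" "\<lambda>b. if b = a then 1 else 0"] by blast
    ultimately show "\<exists>f. eval_r f a \<noteq> 0 \<and> (\<forall>b\<in>\<Omega> - {a}. eval_r f b = 0)"
      by (intro exI[of _ f]) simp
  qed
  fix a b assume ab: "a \<in> \<Lambda>" "b \<in> \<Omega>"
  show "\<not> conjugate a b"
  proof
    assume "conjugate a b"
    then obtain e where e: "\<And>y. a * y - y * b \<noteq> e"
      using sylvester_not_surjective[OF alg[OF ab(1)]] min_poly_root_iff_conjugate[OF alg[OF ab(1)]] by blast
    obtain f where "eval_l f a = e" "eval_r f b = 0"
      using solv[of "\<lambda>_. e" "\<lambda>_. 0"] ab by blast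
    then show False using eval_l_minus_eval_r[of f a b] e by (metis diff_zero)
  qed
qed

lemma P_independent_unique:
  assumes "P_independent \<Lambda> \<Omega>" "deg f \<le> card \<Lambda> + card \<Omega>" "deg g \<le> card \<Lambda> + card \<Omega>"
    and "\<And>a. a \<in> \<Lambda> \<Longrightarrow> eval_l f a = eval_l g a" "\<And>b. b \<in> \<Omega> \<Longrightarrow> eval_r f b = eval_r g b"
  shows "f = g"
proof -
  have "f - g \<in> polys_below (card \<Lambda> + card \<Omega>)"
    using deg_diff_le[OF assms(2,3)] by (simp add: polys_below_def)
  then have "f - g = 0"
    using assms(1,4,5) unfolding P_independent_def
    by (metis eval_l_diff eval_r_diff right_minus_eq)
  then show ?thesis by simp
qed

lemma interpolation_formula:
  fixes \<Lambda> \<Omega> :: "'a::division_ring set" and c d :: "'a \<Rightarrow> 'a"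
  assumes fin: "finite \<Lambda>" "finite \<Omega>" and alg: "\<And>a. a \<in> \<Lambda> \<Longrightarrow> algebraic_over_center a"
    and ind: "P_independent \<Lambda> \<Omega>" and ne: "\<Lambda> \<noteq> {}" "\<Omega> \<noteq> {}"
  defines "w \<equiv> \<lambda>a b e. inverse (eval_l (P_l (\<Lambda> - {a})) a) * Psi a b e * inverse (eval_r (P_r (\<Omega> - {b})) b)"
  defines "f \<equiv> (\<Sum>a\<in>\<Lambda>. P_l (\<Lambda> - {a}) * Const (\<Sum>b\<in>\<Omega>. w a b (c a)) * P_r \<Omega>)
      + (\<Sum>b\<in>\<Omega>. P_l \<Lambda> * Const (- (\<Sum>a\<in>\<Lambda>. w a b (d b))) * P_r (\<Omega> - {b}))"
  shows "deg f \<le> card \<Lambda> + card \<Omega>"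
    and "a \<in> \<Lambda> \<Longrightarrow> eval_l f a = c a" and "b \<in> \<Omega> \<Longrightarrow> eval_r f b = d b"
proof -
  note ind' = P_independentD[OF fin ind]
  have Psi: "a * Psi a b e - Psi a b e * b = e" if "a \<in> \<Lambda>" "b \<in> \<Omega>" for a b e
    using Psi_sylvester[OF alg] min_poly_root_iff_conjugate[OF alg] ind'(3) that by blast
  show "deg f \<le> card \<Lambda> + card \<Omega>"
    unfolding f_def
  proof (intro deg_add_le deg_sum_le)
    fix a assume "a \<in> \<Lambda>"
    then have "Suc (card (\<Lambda> - {a})) = card \<Lambda>" using fin by (intro card_Suc_Diff1)
    moreover have "deg (P_l (\<Lambda> - {a}) * Const r * P_r \<Omega>) \<le> card (\<Lambda> - {a}) + Suc (card \<Omega>)" for r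
      using fin by (intro deg_mult_le order_trans[OF deg_mult_Const_le] deg_P_l_le deg_P_r_le) auto
    ultimately show "deg (P_l (\<Lambda> - {a}) * Const r * P_r \<Omega>) \<le> card \<Lambda> + card \<Omega>" for r
      by (metis add_Suc add_Suc_right)
  next
    fix b assume "b \<in> \<Omega>"
    then have "Suc (card (\<Omega> - {b})) = card \<Omega>" using fin by (intro card_Suc_Diff1)
    moreover have "deg (P_l \<Lambda> * Const r * P_r (\<Omega> - {b})) \<le> card \<Lambda> + Suc (card (\<Omega> - {b}))" for r
      using fin by (intro deg_mult_le order_trans[OF deg_mult_Const_le] deg_P_l_le deg_P_r_le) auto
    ultimately show "deg (P_l \<Lambda> * Const r * P_r (\<Omega> - {b})) \<le> card \<Lambda> + card \<Omega>" for r
      by metis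
  qed
  show "eval_l f a = c a" if a: "a \<in> \<Lambda>"
  proof -
    have "eval_l (P_l (\<Lambda> - {a}) * Const (\<Sum>b\<in>\<Omega>. w a b (c a)) * P_r \<Omega>) a = c a"
      using eval_l_sandwich[OF fin ind'(1,2) a ne(2), of "\<lambda>b. Psi a b (c a)" "c a"] Psi a
      by (simp add: w_def)
    moreover have "eval_l (P_l (\<Lambda> - {a'}) * Const r * P_r \<Omega>) a = 0" if "a' \<noteq> a" for a' r
      using a fin that by (simp add: mult.assoc eval_l_mult_eq_0 eval_l_P_l)
    moreover have "eval_l (P_l \<Lambda> * Const r * P_r (\<Omega> - {b})) a = 0" for b r
      using a fin by (simp add: mult.assoc eval_l_mult_eq_0 eval_l_P_l)
    ultimately show ?thesis
      using a fin by (simp add: f_def eval_l_add eval_l_sum sum.remove[of \<Lambda> a])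
  qed
  show "eval_r f b = d b" if b: "b \<in> \<Omega>"
  proof -
    have "eval_r (P_l \<Lambda> * Const (- (\<Sum>a\<in>\<Lambda>. w a b (d b))) * P_r (\<Omega> - {b})) b = d b"
      using eval_r_sandwich[OF fin ind'(1,2) b ne(1), of "\<lambda>a. Psi a b (d b)" "d b"] Psi b
      by (simp add: w_def)
    moreover have "eval_r (P_l \<Lambda> * Const r * P_r (\<Omega> - {b'})) b = 0" if "b' \<noteq> b" for b' r
      using b fin that by (simp add: eval_r_mult_eq_0 eval_r_P_r)
    moreover have "eval_r (P_l (\<Lambda> - {a}) * Const r * P_r \<Omega>) b = 0" for a r
      using b fin by (simp add: eval_r_mult_eq_0 eval_r_P_r)
    ultimately show ?thesis
      using b fin by (simp add: f_def eval_r_add eval_r_sum sum.remove[of \<Omega> b])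
  qed
qed

text \<open>
  If one of the two sets is empty, the formula degenerates to \<open>0\<close> and ordinary one-sided interpolation
  takes its place.
\<close>

lemma interpolation_exists:
  assumes fin: "finite \<Lambda>" "finite \<Omega>" and alg: "\<And>a. a \<in> \<Lambda> \<Longrightarrow> algebraic_over_center a"
    and ind: "P_independent \<Lambda> \<Omega>"
  shows "\<exists>f. deg f \<le> card \<Lambda> + card \<Omega> \<and>
    (\<forall>a\<in>\<Lambda>. eval_l f a = c a) \<and> (\<forall>b\<in>\<Omega>. eval_r f b = d b)"
proof -
  consider "\<Omega> = {}" | "\<Lambda> = {}" | "\<Lambda> \<noteq> {}" "\<Omega> \<noteq> {}" by blast
  then show ?thesis
  proof cases
    case 1 then show ?thesis
      using left_interpolation[OF fin(1) P_independentD(1)[OF fin ind]] by simp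
  next
    case 2 then show ?thesis
      using right_interpolation[OF fin(2) P_independentD(2)[OF fin ind]] by simp
  next
    case 3 then show ?thesis
      using interpolation_formula[OF fin alg ind, where c = c and d = d] by blast
  qed
qed

theorem theorem3p13:
  fixes n k :: nat
    and \<alpha> \<beta> :: "nat \<Rightarrow> 'a::division_ring"
    and \<Lambda> \<Omega> :: "'a set"
    and interpolates :: "(nat \<Rightarrow>\<^sub>0 'a) \<Rightarrow> (nat \<Rightarrow> 'a) \<Rightarrow> (nat \<Rightarrow> 'a) \<Rightarrow> bool"
  assumes "\<Lambda> = \<alpha> ` {1..n}" and "inj_on \<alpha> {1..n}"
    and "\<Omega> = \<beta> ` {1..k}" and "inj_on \<beta> {1..k}"
    and "\<forall>i\<in>{1..n}. algebraic_over_center (\<alpha> i)"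
  defines "interpolates \<equiv> \<lambda>f c d.
    (\<forall>i\<in>{1..n}. eval_l f (\<alpha> i) = c i) \<and> (\<forall>j\<in>{1..k}. eval_r f (\<beta> j) = d j)"
  shows "((\<forall>c d. \<exists>f\<in>polys_below (n + k). interpolates f c d) \<longleftrightarrow> P_independent \<Lambda> \<Omega>) \<and>
    (P_independent \<Lambda> \<Omega> \<longrightarrow> (\<forall>c d.
      (\<exists>!f. f \<in> polys_below (n + k) \<and> interpolates f c d) \<and>
      (1 \<le> n \<and> 1 \<le> k \<longrightarrow>
        (let \<rho> = (\<lambda>i. \<Sum>j=1..k. inverse (eval_l (P_l (\<Lambda> - {\<alpha> i})) (\<alpha> i))
                     * Psi (\<alpha> i) (\<beta> j) (c i)
                     * inverse (eval_r (P_r (\<Omega> - {\<beta> j})) (\<beta> j)));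
             \<gamma> = (\<lambda>j. - (\<Sum>i=1..n. inverse (eval_l (P_l (\<Lambda> - {\<alpha> i})) (\<alpha> i))
                     * Psi (\<alpha> i) (\<beta> j) (d j)
                     * inverse (eval_r (P_r (\<Omega> - {\<beta> j})) (\<beta> j))));
             f = (\<Sum>i=1..n. P_l (\<Lambda> - {\<alpha> i}) * Const (\<rho> i) * P_r \<Omega>)
               + (\<Sum>j=1..k. P_l \<Lambda> * Const (\<gamma> j) * P_r (\<Omega> - {\<beta> j}))
         in f \<in> polys_below (n + k) \<and> interpolates f c d))))"
proof -
  have fin: "finite \<Lambda>" "finite \<Omega>" and card: "card \<Lambda> = n" "card \<Omega> = k"
    using assms(1-4) by (simp_all add: card_image)
  have alg: "algebraic_over_center a" if "a \<in> \<Lambda>" for a using assms(1,5) that by auto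
  \<comment> \<open>Data indexed by \<open>i\<close> and \<open>j\<close>, turned into functions of the points.\<close>
  define C where "C c = c \<circ> the_inv_into {1..n} \<alpha>" for c :: "nat \<Rightarrow> 'a"
  define D where "D d = d \<circ> the_inv_into {1..k} \<beta>" for d :: "nat \<Rightarrow> 'a"
  have C: "C c (\<alpha> i) = c i" if "i \<in> {1..n}" for c i
    using the_inv_into_f_f[OF assms(2) that] by (simp add: C_def)
  have D: "D d (\<beta> j) = d j" if "j \<in> {1..k}" for d j
    using the_inv_into_f_f[OF assms(4) that] by (simp add: D_def)
  have interp: "interpolates f c d \<longleftrightarrow>
      (\<forall>a\<in>\<Lambda>. eval_l f a = C c a) \<and> (\<forall>b\<in>\<Omega>. eval_r f b = D d b)" for f c d
    by (simp add: interpolates_def assms(1,3) C D)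
  have below: "f \<in> polys_below (n + k) \<longleftrightarrow> deg f \<le> card \<Lambda> + card \<Omega>" for f :: "nat \<Rightarrow>\<^sub>0 'a"
    by (simp add: polys_below_def card)
  note sum_indexed = sum.reindex[OF assms(2), folded assms(1)] sum.reindex[OF assms(4), folded assms(3)]
  have "P_independent \<Lambda> \<Omega>" if *: "\<forall>c d. \<exists>f\<in>polys_below (n + k). interpolates f c d"
  proof (rule P_independent_of_solvable[OF fin alg])
    fix c d :: "'a \<Rightarrow> 'a"
    obtain f where "interpolates f (c \<circ> \<alpha>) (d \<circ> \<beta>)" using * by blast
    then show "\<exists>f. (\<forall>a\<in>\<Lambda>. eval_l f a = c a) \<and> (\<forall>b\<in>\<Omega>. eval_r f b = d b)"
      by (auto simp: interpolates_def assms(1,3))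
  qed
  moreover have "\<exists>!f. f \<in> polys_below (n + k) \<and> interpolates f c d"
    if ind: "P_independent \<Lambda> \<Omega>" for c d
    unfolding below interp
    using interpolation_exists[OF fin alg ind, of "C c" "D d"] P_independent_unique[OF ind]
    by (intro ex_ex1I) simp_all
  moreover have "(let \<rho> = (\<lambda>i. \<Sum>j=1..k. inverse (eval_l (P_l (\<Lambda> - {\<alpha> i})) (\<alpha> i))
                     * Psi (\<alpha> i) (\<beta> j) (c i)
                     * inverse (eval_r (P_r (\<Omega> - {\<beta> j})) (\<beta> j)));
             \<gamma> = (\<lambda>j. - (\<Sum>i=1..n. inverse (eval_l (P_l (\<Lambda> - {\<alpha> i})) (\<alpha> i))
                     * Psi (\<alpha> i) (\<beta> j) (d j)
                     * inverse (eval_r (P_r (\<Omega> - {\<beta> j})) (\<beta> j))));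
             f = (\<Sum>i=1..n. P_l (\<Lambda> - {\<alpha> i}) * Const (\<rho> i) * P_r \<Omega>)
               + (\<Sum>j=1..k. P_l \<Lambda> * Const (\<gamma> j) * P_r (\<Omega> - {\<beta> j}))
         in f \<in> polys_below (n + k) \<and> interpolates f c d)"
    if ind: "P_independent \<Lambda> \<Omega>" and "1 \<le> n \<and> 1 \<le> k" for c d
  proof -
    have ne: "\<Lambda> \<noteq> {}" "\<Omega> \<noteq> {}" using card that(2) by auto
    define w where "w a b e = inverse (eval_l (P_l (\<Lambda> - {a})) a) * Psi a b e
        * inverse (eval_r (P_r (\<Omega> - {b})) b)" for a b e
    define f where "f = (\<Sum>i=1..n. P_l (\<Lambda> - {\<alpha> i}) * Const (\<Sum>j=1..k. w (\<alpha> i) (\<beta> j) (c i)) * P_r \<Omega>)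
        + (\<Sum>j=1..k. P_l \<Lambda> * Const (- (\<Sum>i=1..n. w (\<alpha> i) (\<beta> j) (d j))) * P_r (\<Omega> - {\<beta> j}))"
    have f: "f = (\<Sum>a\<in>\<Lambda>. P_l (\<Lambda> - {a}) * Const (\<Sum>b\<in>\<Omega>. w a b (C c a)) * P_r \<Omega>)
        + (\<Sum>b\<in>\<Omega>. P_l \<Lambda> * Const (- (\<Sum>a\<in>\<Lambda>. w a b (D d b))) * P_r (\<Omega> - {b}))"
      unfolding f_def sum_indexed o_def by (simp add: C D cong: sum.cong_simp)
    have "deg f \<le> card \<Lambda> + card \<Omega> \<and> interpolates f c d"
      unfolding interp f w_def using interpolation_formula[OF fin alg ind ne, where c = "C c" and d = "D d"] by blast
    then show ?thesis unfolding Let_def below f_def w_def .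
  qed
  ultimately show ?thesis by blast
qed

end
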